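(* Let $m$ and $n$ be integers with $n > m > 2$, and define the groups \[G=\langle x,y,z \mid z=[y,x],\ x^{2^n}=y^{2^m}=z^4=1,\ z^x=z^{-1},\ z^y=z^{-1}\rangle,\] \[H=\langle a,b,c \mid c=[b,a],\ a^{2^n}=b^{2^m}=c^4=1,\ c^a=c^{-1},\ c^b=c\rangle.\] Let $k$ be any field of characteristic $2$. Then in the group algebra $kH$ the elements $a$ and $b(a+b+ab)c$ generate a group basis of $kH$ which is isomorphic to $G$. In particular $kG \cong kH$.
   Context: Commutators are $[g,h]=g^{-1}h^{-1}gh$ and $g^h = h^{-1}gh$. For a group algebra $kH$, the augmentation $\varepsilon:kH\to k$ sends $\sum_h r_h h$ to $\sum_h r_h$; $V(kH)$ denotes the group of units of $kH$ of augmentation $1$. A group basis of $kH$ is a subgroup of $V(kH)$ which is a $k$-basis of $kH$. *)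

theory Defs
  imports Main "HOL-Algebra.Generated_Groups"
begin

definition comm :: "('a, 'b) monoid_scheme \<Rightarrow> 'a \<Rightarrow> 'a \<Rightarrow> 'a" where
  "comm K g h = inv\<^bsub>K\<^esub> g \<otimes>\<^bsub>K\<^esub> inv\<^bsub>K\<^esub> h \<otimes>\<^bsub>K\<^esub> g \<otimes>\<^bsub>K\<^esub> h"

definition conj :: "('a, 'b) monoid_scheme \<Rightarrow> 'a \<Rightarrow> 'a \<Rightarrow> 'a" where
  "conj K g h = inv\<^bsub>K\<^esub> h \<otimes>\<^bsub>K\<^esub> g \<otimes>\<^bsub>K\<^esub> h"

definition G_rel :: "('a, 'b) monoid_scheme \<Rightarrow> nat \<Rightarrow> nat \<Rightarrow> 'a \<Rightarrow> 'a \<Rightarrow> 'a \<Rightarrow> bool" where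
  "G_rel K n m x y z \<longleftrightarrow> x \<in> carrier K \<and> y \<in> carrier K \<and> z \<in> carrier K \<and>
     z = comm K y x \<and> x [^]\<^bsub>K\<^esub> ((2::nat) ^ n) = \<one>\<^bsub>K\<^esub> \<and>
     y [^]\<^bsub>K\<^esub> ((2::nat) ^ m) = \<one>\<^bsub>K\<^esub> \<and> z [^]\<^bsub>K\<^esub> (4::nat) = \<one>\<^bsub>K\<^esub> \<and>
     conj K z x = inv\<^bsub>K\<^esub> z \<and> conj K z y = inv\<^bsub>K\<^esub> z"

definition H_rel :: "('a, 'b) monoid_scheme \<Rightarrow> nat \<Rightarrow> nat \<Rightarrow> 'a \<Rightarrow> 'a \<Rightarrow> 'a \<Rightarrow> bool" where
  "H_rel K n m a b c \<longleftrightarrow> a \<in> carrier K \<and> b \<in> carrier K \<and> c \<in> carrier K \<and>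
     c = comm K b a \<and> a [^]\<^bsub>K\<^esub> ((2::nat) ^ n) = \<one>\<^bsub>K\<^esub> \<and>
     b [^]\<^bsub>K\<^esub> ((2::nat) ^ m) = \<one>\<^bsub>K\<^esub> \<and> c [^]\<^bsub>K\<^esub> (4::nat) = \<one>\<^bsub>K\<^esub> \<and>
     conj K c a = inv\<^bsub>K\<^esub> c \<and> conj K c b = c"

text \<open>K is the group presented by generators x,y,z and the relations: K is a group
  generated by x,y,z which satisfy the relations, and (universal property) for every
  group L and elements satisfying the relations there is a homomorphism K \<rightarrow> L sending
  the generators to them. The test groups L are taken with carrier in nat; since every
  3-generated group is countable, this is equivalent to the universal property over all
  groups (restrict to the subgroup generated by the images and transport to nat).\<close>

definition is_G_presented :: "('a, 'b) monoid_scheme \<Rightarrow> nat \<Rightarrow> nat \<Rightarrow> 'a \<Rightarrow> 'a \<Rightarrow> 'a \<Rightarrow> bool" where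
  "is_G_presented K n m x y z \<longleftrightarrow> group K \<and> G_rel K n m x y z \<and>
     generate K {x, y, z} = carrier K \<and>
     (\<forall>(L :: nat monoid) x' y' z'. group L \<and> G_rel L n m x' y' z' \<longrightarrow>
        (\<exists>\<phi> \<in> hom K L. \<phi> x = x' \<and> \<phi> y = y' \<and> \<phi> z = z'))"

definition is_H_presented :: "('a, 'b) monoid_scheme \<Rightarrow> nat \<Rightarrow> nat \<Rightarrow> 'a \<Rightarrow> 'a \<Rightarrow> 'a \<Rightarrow> bool" where
  "is_H_presented K n m a b c \<longleftrightarrow> group K \<and> H_rel K n m a b c \<and>
     generate K {a, b, c} = carrier K \<and>
     (\<forall>(L :: nat monoid) a' b' c'. group L \<and> H_rel L n m a' b' c' \<longrightarrow>
        (\<exists>\<phi> \<in> hom K L. \<phi> a = a' \<and> \<phi> b = b' \<and> \<phi> c = c'))"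

text \<open>Elements of kH are functions H \<rightarrow> k vanishing outside the carrier of H
  (H is finite here, so every such function is finitely supported).\<close>

definition galg_carrier :: "('a, 'b) monoid_scheme \<Rightarrow> ('a \<Rightarrow> 'k::field) set" where
  "galg_carrier K = {f. \<forall>h. h \<notin> carrier K \<longrightarrow> f h = 0}"

definition galg_mult :: "('a, 'b) monoid_scheme \<Rightarrow> ('a \<Rightarrow> 'k::field) \<Rightarrow> ('a \<Rightarrow> 'k) \<Rightarrow> ('a \<Rightarrow> 'k)" where
  "galg_mult K f g = (\<lambda>h. if h \<in> carrier K
      then (\<Sum>u\<in>carrier K. f u * g (inv\<^bsub>K\<^esub> u \<otimes>\<^bsub>K\<^esub> h)) else 0)"

definition delta :: "'a \<Rightarrow> ('a \<Rightarrow> 'k::field)" where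
  "delta g = (\<lambda>h. if h = g then 1 else 0)"

definition galg_add :: "('a \<Rightarrow> 'k::field) \<Rightarrow> ('a \<Rightarrow> 'k) \<Rightarrow> ('a \<Rightarrow> 'k)" where
  "galg_add f g = (\<lambda>h. f h + g h)"

definition galg_smult :: "'k::field \<Rightarrow> ('a \<Rightarrow> 'k) \<Rightarrow> ('a \<Rightarrow> 'k)" where
  "galg_smult r f = (\<lambda>h. r * f h)"

definition galg :: "('a, 'b) monoid_scheme \<Rightarrow> ('a \<Rightarrow> 'k::field) monoid" where
  "galg K = \<lparr>carrier = galg_carrier K, mult = galg_mult K, one = delta \<one>\<^bsub>K\<^esub>\<rparr>"

definition augmentation :: "('a, 'b) monoid_scheme \<Rightarrow> ('a \<Rightarrow> 'k::field) \<Rightarrow> 'k" where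
  "augmentation K f = (\<Sum>h\<in>carrier K. f h)"

definition normalized_units :: "('a, 'b) monoid_scheme \<Rightarrow> ('a \<Rightarrow> 'k::field) set" where
  "normalized_units K = {u \<in> Units (galg K). augmentation K u = 1}"

definition is_k_basis :: "('a, 'b) monoid_scheme \<Rightarrow> ('a \<Rightarrow> 'k::field) set \<Rightarrow> bool" where
  "is_k_basis K U \<longleftrightarrow> U \<subseteq> galg_carrier K \<and>
     (\<forall>f \<in> galg_carrier K. \<exists>!c :: ('a \<Rightarrow> 'k) \<Rightarrow> 'k.
        finite {u. c u \<noteq> 0} \<and> {u. c u \<noteq> 0} \<subseteq> U \<and>
        f = (\<lambda>h. \<Sum>u\<in>{u. c u \<noteq> 0}. c u * u h))"

definition is_group_basis :: "('a, 'b) monoid_scheme \<Rightarrow> ('a \<Rightarrow> 'k::field) set \<Rightarrow> bool" where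
  "is_group_basis K U \<longleftrightarrow> subgroup U (units_of (galg K)) \<and> U \<subseteq> normalized_units K \<and>
     is_k_basis K U"

definition galg_isomorphic :: "('a, 'b) monoid_scheme \<Rightarrow> ('c, 'd) monoid_scheme \<Rightarrow> 'k::field itself \<Rightarrow> bool" where
  "galg_isomorphic K L _ \<longleftrightarrow> (\<exists>\<phi> :: ('a \<Rightarrow> 'k) \<Rightarrow> ('c \<Rightarrow> 'k).
     bij_betw \<phi> (galg_carrier K) (galg_carrier L) \<and>
     (\<forall>f \<in> galg_carrier K. \<forall>g \<in> galg_carrier K.
        \<phi> (galg_add f g) = galg_add (\<phi> f) (\<phi> g) \<and>
        \<phi> (galg_mult K f g) = galg_mult L (\<phi> f) (\<phi> g)) \<and>
     (\<forall>r. \<forall>f \<in> galg_carrier K. \<phi> (galg_smult r f) = galg_smult r (\<phi> f)) \<and>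
     \<phi> (delta \<one>\<^bsub>K\<^esub>) = delta \<one>\<^bsub>L\<^esub>)"

end

theory Submission
  imports Defs "HOL-Algebra.Weak_Morphisms" "HOL.Vector_Spaces" "HOL-Library.Function_Algebras"
begin

text \<open>
  Since \<open>b a = a b c\<close>, we have \<open>\<beta> = b (a + b + a b) c = u + a v\<close> with \<open>u = b\<^sup>2 c\<close> and \<open>v = (b + b\<^sup>2) c\<^sup>2\<close>.
  In characteristic 2 this makes \<open>a\<^sup>2\<close> and \<open>\<beta>\<^sup>2\<close> central and gives \<open>\<beta>\<^bsup>2^m\<^esup> = 1\<close>.
  Moreover \<open>q = a \<beta> + \<beta> a\<close> is a nilpotent element with \<open>q\<^sup>4 = 0\<close>, so that
  \<open>(a \<beta>)\<^sup>4 = (\<beta> a)\<^sup>4\<close> and \<open>[\<beta>, a]\<^sup>4 = 1\<close>. So \<open>a, \<beta>\<close> satisfy the relations of \<open>G\<close>, and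
  \<open>kG\<close> maps to \<open>kH\<close>.

  This map is onto. As \<open>q\<close> is \<open>1 + c\<close> times a unit, the right ideal generated by \<open>X = 1 + a\<close> and
  \<open>W = 1 + \<beta>\<close> contains \<open>1 + c\<close>, then \<open>1 + b\<close>, hence it is the augmentation ideal, and
  \<open>kH = S + X kH + W kH\<close> for the image \<open>S\<close>. Iterating once and using that
  \<open>X\<^sup>2\<close>, \<open>W\<^sup>2\<close> and \<open>X W + W X = q\<close> lie in \<open>S\<close> and commute with each other gives
  \<open>kH = S + X\<^sup>2 kH + W\<^sup>2 kH + q kH\<close>; as the three elements are nilpotent, \<open>kH = S\<close>.
  Finally \<open>|G| \<le> 2\<^bsup>n+m+2\<^esup> \<le> |H|\<close>, by normal forms for \<open>G\<close> and an explicit model of \<open>H\<close>,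
  so the map is bijective.
\<close>

subsection \<open>The relations in characteristic 2\<close>

text \<open>The mixed terms \<open>p * r + r * p\<close> cancel, so squaring is additive on
  commuting elements. Their squares commute again, which lets the induction continue.\<close>

lemma char2_power_two_power:
  fixes p r :: "'r::ring_1"
  assumes char2: "\<And>x::'r. x + x = 0" and "p * r = r * p"
  shows "(p + r) ^ (2 ^ k) = p ^ (2 ^ k) + r ^ (2 ^ k)"
  using assms(2)
proof (induction k arbitrary: p r)
  case (Suc k)
  have "(p + r)\<^sup>2 = p\<^sup>2 + r\<^sup>2 + (r * p + r * p)"
    using Suc.prems by (simp add: power2_eq_square algebra_simps)
  then have sq: "(p + r)\<^sup>2 = p\<^sup>2 + r\<^sup>2"
    by (simp add: char2)
  have "p\<^sup>2 * r\<^sup>2 = r\<^sup>2 * p\<^sup>2"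
    using Suc.prems by (metis power_commuting_commutes)
  from Suc.IH[OF this] show ?case
    by (simp add: power_mult sq)
qed simp

lemma power_mult_commuting:
  fixes p s :: "'r::monoid_mult"
  assumes "p * s = s * p"
  shows "(p * s) ^ k = p ^ k * s ^ k"
proof (induction k)
  case (Suc k)
  have "p * s * (p ^ k * s ^ k) = p * (s * p ^ k) * s ^ k"
    by (simp add: mult.assoc)
  also have "s * p ^ k = p ^ k * s"
    using power_commuting_commutes[OF assms] by simp
  finally show ?case
    by (simp add: Suc mult.assoc)
qed simp

text \<open>A noncommutative form of Nakayama's lemma.\<close>

lemma nilpotent_absorption:
  fixes A S :: "'r::ring_1 set"
  assumes cover: "\<And>x. x \<in> A \<Longrightarrow> \<exists>s\<in>S. \<exists>y\<in>A. x = s + t * y"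
    and add: "\<And>s s'. s \<in> S \<Longrightarrow> s' \<in> S \<Longrightarrow> s + s' \<in> S"
    and mult: "\<And>s. s \<in> S \<Longrightarrow> t * s \<in> S"
    and nil: "t ^ N = 0"
  shows "A \<subseteq> S"
proof
  fix x assume x: "x \<in> A"
  have mult_power: "t ^ k * s \<in> S" if "s \<in> S" for s k
    using that by (induction k) (auto simp: mult.assoc mult)
  \<comment> \<open>Decomposing the remainder \<open>y\<close> once more raises the power of
    \<open>t\<close> in front of it. The powers stay on the left, so closure of \<open>S\<close>
    under left multiplication by \<open>t\<close> suffices, and at exponent \<open>Suc N\<close> the
    remainder is zero.\<close>
  have "\<exists>s\<in>S. \<exists>y\<in>A. x = s + t ^ Suc k * y" for k
  proof (induction k)
    case (Suc k)
    then obtain s y where sy: "s \<in> S" "y \<in> A" "x = s + t ^ Suc k * y" by blast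
    obtain s' y' where s': "s' \<in> S" "y' \<in> A" "y = s' + t * y'" using cover[OF sy(2)] by blast
    have "x = (s + t ^ Suc k * s') + t ^ Suc (Suc k) * y'"
      using sy(3) s'(3) by (simp add: distrib_left add.assoc power_Suc2 mult.assoc del: power_Suc)
    then show ?case using add sy(1) s'(1,2) mult_power by blast
  qed (simp add: cover x)
  from this[of N] show "x \<in> S" using nil by auto
qed

text \<open>The relations of \<open>H\<close> in inverse-free form, for use in a ring:
  \<open>c = [b, a]\<close> becomes \<open>b * a = a * b * c\<close>, and \<open>c ^ 3\<close>
  stands for the inverse of \<open>c\<close>.\<close>

locale H_relations =
  fixes a b c :: "'r::ring_1" and n m :: nat
  assumes char2: "\<And>x::'r. x + x = 0"
    and ba: "b * a = a * b * c" and ca: "c * a = a * c ^ 3" and cb: "c * b = b * c"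
    and a_power: "a ^ (2 ^ n) = 1" and b_power: "b ^ (2 ^ m) = 1" and c_power: "c ^ 4 = 1"
    and m_gt: "2 < m" and n_gt: "m < n"
begin

definition \<beta> where "\<beta> = b * (a + b + a * b) * c"

text \<open>With \<open>v' = b c\<^sup>3 + b\<^sup>2\<close>, so that \<open>v a = a v'\<close> and \<open>v' a = a v\<close>, these are
  \<open>d = v + v' = (1 + c) w\<close> and \<open>r = v v'\<close>; they satisfy \<open>q = a\<^sup>2 d\<close> and \<open>\<beta>\<^sup>2 = u\<^sup>2 + a\<^sup>2 r\<close>.\<close>

definition d where "d = b * c\<^sup>2 + b\<^sup>2 * c\<^sup>2 + b * c ^ 3 + b\<^sup>2"

definition w where "w = b * c\<^sup>2 + b\<^sup>2 + b\<^sup>2 * c"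

definition r where "r = (b + b\<^sup>2) * c\<^sup>2 * (b * c ^ 3 + b\<^sup>2)"

lemma char2': "x + (x + y) = (y::'r)"
  by (metis add.assoc add.left_neutral char2)

text \<open>The rules move \<open>a\<close> to the left and \<open>c\<close> to the right, towards
  words \<open>a^i b^j c^l\<close> with \<open>l < 4\<close>. Each comes a second time with a
  trailing factor \<open>y\<close>, so that it also applies inside a right-associated
  product.\<close>

lemma normalize:
  "b * a = a * (b * c)" "b * (a * y) = a * (b * (c * y))"
  "c * a = a * (c * (c * c))" "c * (a * y) = a * (c * (c * (c * y)))"
  "c * b = b * c" "c * (b * y) = b * (c * y)"
  "c * (c * (c * c)) = 1" "c * (c * (c * (c * y))) = y"
proof -
  show 1: "b * a = a * (b * c)" by (simp add: ba mult.assoc)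
  show "b * (a * y) = a * (b * (c * y))" by (metis 1 mult.assoc)
  show 2: "c * a = a * (c * (c * c))" by (simp add: ca power3_eq_cube mult.assoc)
  show "c * (a * y) = a * (c * (c * (c * y)))" by (metis 2 mult.assoc)
  show "c * b = b * c" by (rule cb)
  show "c * (b * y) = b * (c * y)" by (metis cb mult.assoc)
  show 3: "c * (c * (c * c)) = 1" using c_power by (simp add: power4_eq_xxxx mult.assoc)
  show "c * (c * (c * (c * y))) = y" by (metis 3 mult.assoc mult_1)
qed

text \<open>Rewriting with these equations brings polynomials in \<open>a, b, c\<close> to a normal form.\<close>

lemmas expand = \<beta>_def d_def w_def r_def power2_eq_square power3_eq_cube power4_eq_xxxx
  distrib_left distrib_right mult.assoc normalize add_ac char2 char2'

text \<open>Write \<open>\<beta> = u + a v\<close>. The element \<open>u\<close> commutes with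
  \<open>a\<close> and \<open>v\<close>, so the mixed terms cancel, and
  \<open>(a v)^2 = a^2 v' v = a^2 r\<close>.\<close>

lemma \<beta>_square: "\<beta>\<^sup>2 = (b\<^sup>2 * c)\<^sup>2 + a\<^sup>2 * r"
  by (simp add: expand)

text \<open>Moving past \<open>a\<close> swaps \<open>v\<close> and \<open>v'\<close>. This fixes
  their product \<open>r\<close> and, in the next lemma, their sum \<open>d\<close>.\<close>

lemma a_r_commute: "a * r = r * a"
  by (simp add: expand)

lemma a_d_commute: "a * d = d * a"
  by (simp add: expand)

lemma a_\<beta>_square: "a * \<beta>\<^sup>2 = \<beta>\<^sup>2 * a"
  unfolding \<beta>_square by (simp add: expand)

lemma a_\<beta>_anticommutator: "a * \<beta> + \<beta> * a = a\<^sup>2 * d"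
  by (simp add: expand)

lemma d_factor: "d = (1 + c) * w"
  by (simp add: expand)

text \<open>As \<open>b\<close> and \<open>c\<close> commute, the fourth power is taken termwise:
  \<open>b^4 c^8 + b^8 + b^8 c^4\<close>, where the last two terms cancel. Hence \<open>w\<close> is
  a unit, and \<open>d^4\<close> vanishes with \<open>(1 + c)^4 = 1 + c^4\<close>.\<close>

lemma w_power: "w ^ 4 = b ^ 4"
  by (simp add: expand)

lemma d_power: "d ^ 4 = 0"
  by (simp add: expand)

lemma r_power: "r ^ 2 ^ (m - 1) = 0"
proof -
  \<comment> \<open>Here \<open>2 < m\<close> enters: the exponent \<open>2 ^ (m - 1)\<close> is
    \<open>4 * 2 ^ k\<close>, so the formula for \<open>r ^ 4\<close> can be raised to the power
    \<open>2 ^ k\<close>. The two terms become \<open>b^(2^m)\<close> and its square, both equal to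
    1.\<close>
  obtain k where k: "m = k + 3"
    using m_gt that[of "m - 3"] by simp
  have "r ^ 4 = (b ^ 4)\<^sup>2 + ((b ^ 4)\<^sup>2)\<^sup>2"
    by (simp add: expand)
  then have r4: "r ^ 4 = b ^ 8 + b ^ 16"
    by (simp flip: power_mult)
  have "r ^ 2 ^ (m - 1) = (b ^ 8 + b ^ 16) ^ 2 ^ k"
    by (simp add: k power_add flip: r4 power_mult)
  also have "\<dots> = b ^ (8 * 2 ^ k) + b ^ (16 * 2 ^ k)"
    by (subst char2_power_two_power[OF char2])
      (simp_all only: power_mult flip: power_add, simp add: add.commute)
  also have "8 * 2 ^ k = (2 ^ m :: nat)"
    by (simp add: k power_add)
  also have "16 * 2 ^ k = (2 ^ m * 2:: nat)"
    by (simp add: k power_add)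
  finally show ?thesis
    by (simp add: power_mult b_power char2)
qed

text \<open>The two summands of \<open>\<beta>\<^sup>2\<close> commute, so the power
  \<open>2 ^ (m - 1)\<close> acts on each of them. The first gives 1 because
  \<open>u^4 = b^8\<close>, and the second vanishes with the power of \<open>r\<close>.\<close>

lemma \<beta>_power: "\<beta> ^ 2 ^ m = 1"
proof -
  have m: "2 ^ m = 2 * (2::nat) ^ (m - 1)" "2 ^ m = 4 * (2::nat) ^ (m - 2)"
    using m_gt le_add_diff_inverse[of 1 m] le_add_diff_inverse[of 2 m] power_add[of "2::nat" 1 "m - 1"]
      power_add[of "2::nat" 2 "m - 2"] by (simp_all only: power2_eq_square) simp_all
  have "(b\<^sup>2 * c) ^ 4 = (b ^ 4)\<^sup>2"
    by (simp add: expand)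
  then have u: "(b\<^sup>2 * c) ^ 4 = b ^ 8"
    by (simp flip: power_mult)
  have "(b\<^sup>2 * c) ^ 2 ^ m = (b ^ 8) ^ 2 ^ (m - 2)"
    unfolding m(2) power_mult u ..
  also have "\<dots> = (b ^ 2 ^ m) ^ 2"
    unfolding m(2) by (simp add: mult_ac flip: power_mult)
  finally have u: "(b\<^sup>2 * c) ^ 2 ^ m = 1"
    by (simp add: b_power)
  have ar: "a\<^sup>2 * r = r * a\<^sup>2"
    by (rule power_commuting_commutes[OF a_r_commute])
  have "\<beta> ^ 2 ^ m = ((b\<^sup>2 * c)\<^sup>2 + a\<^sup>2 * r) ^ 2 ^ (m - 1)"
    unfolding m(1) power_mult \<beta>_square ..
  also have "\<dots> = ((b\<^sup>2 * c)\<^sup>2) ^ 2 ^ (m - 1) + (a\<^sup>2 * r) ^ 2 ^ (m - 1)"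
    by (rule char2_power_two_power) (simp_all add: expand)
  also have "(a\<^sup>2 * r) ^ 2 ^ (m - 1) = 0"
    using r_power by (simp add: power_mult_commuting[OF ar])
  finally show ?thesis
    using u by (simp add: m(1) power_mult)
qed

lemma q_power: "(a\<^sup>2 * d) ^ 4 = 0"
proof -
  have "a\<^sup>2 * d = d * a\<^sup>2"
    by (rule power_commuting_commutes[OF a_d_commute])
  then show ?thesis
    by (simp add: power_mult_commuting d_power)
qed

lemma a_square_\<beta>: "\<beta> * a\<^sup>2 = a\<^sup>2 * \<beta>"
  by (simp add: expand)

text \<open>Because \<open>a\<^sup>2\<close> commutes with \<open>\<beta>\<close> and
  \<open>\<beta>\<^sup>2\<close> with \<open>a\<close>, the products \<open>a * \<beta>\<close> and
  \<open>\<beta> * a\<close> commute. Their sum is \<open>q\<close>, so \<open>q^4 = 0\<close> is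
  the sum of their fourth powers. In the unit group this becomes
  \<open>[\<beta>, a]^4 = 1\<close>.\<close>

lemma a_\<beta>_fourth_power: "(a * \<beta>) ^ 4 = (\<beta> * a) ^ 4"
proof -
  have "(a * \<beta>) * (\<beta> * a) = a * \<beta>\<^sup>2 * a"
    by (simp add: power2_eq_square mult.assoc)
  also have "\<dots> = \<beta>\<^sup>2 * a\<^sup>2"
    by (simp add: a_\<beta>_square power2_eq_square[of a] mult.assoc)
  also have "\<dots> = \<beta> * (\<beta> * a\<^sup>2)"
    by (simp add: power2_eq_square mult.assoc)
  also have "\<dots> = (\<beta> * a) * (a * \<beta>)"
    by (simp add: a_square_\<beta>) (simp add: power2_eq_square mult.assoc)
  finally have "(a * \<beta> + \<beta> * a) ^ 4 = (a * \<beta>) ^ 4 + (\<beta> * a) ^ 4"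
    using char2_power_two_power[OF char2, of "a * \<beta>" "\<beta> * a" 2] by simp
  then have "(a * \<beta>) ^ 4 + (\<beta> * a) ^ 4 = 0"
    by (simp add: a_\<beta>_anticommutator q_power)
  then show ?thesis
    by (metis char2 add_right_cancel)
qed

text \<open>Here \<open>A\<close> plays the role of \<open>kH\<close> and \<open>S\<close> that of
  the image of \<open>kG\<close>. The hypothesis \<open>cover\<close> stands for two facts:
  \<open>kH\<close> is the sum of the scalars and its augmentation ideal, and a right ideal that
  contains \<open>1 + a\<close>, \<open>1 + b\<close>, \<open>1 + c\<close> contains the
  augmentation ideal.\<close>

lemma subset_if_a_\<beta>_mem:
  assumes A_add: "\<And>x y. x \<in> A \<Longrightarrow> y \<in> A \<Longrightarrow> x + y \<in> A"
    and A_mult: "\<And>x y. x \<in> A \<Longrightarrow> y \<in> A \<Longrightarrow> x * y \<in> A"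
    and A_mem: "1 \<in> A" "a \<in> A" "b \<in> A" "c \<in> A"
    and S_add: "\<And>x y. x \<in> S \<Longrightarrow> y \<in> S \<Longrightarrow> x + y \<in> S"
    and S_mult: "\<And>x y. x \<in> S \<Longrightarrow> y \<in> S \<Longrightarrow> x * y \<in> S"
    and S_mem: "1 \<in> S" "a \<in> S" "\<beta> \<in> S"
    and cover: "\<And>Q. (\<And>x y. x \<in> Q \<Longrightarrow> y \<in> Q \<Longrightarrow> x + y \<in> Q) \<Longrightarrow>
        (\<And>x y. x \<in> Q \<Longrightarrow> y \<in> A \<Longrightarrow> x * y \<in> Q) \<Longrightarrow>
        1 + a \<in> Q \<Longrightarrow> 1 + b \<in> Q \<Longrightarrow> 1 + c \<in> Q \<Longrightarrow>
        A \<subseteq> {s + x | s x. s \<in> S \<and> x \<in> Q}"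
  shows "A \<subseteq> S"
proof -
  define X where "X = 1 + a"
  define W where "W = 1 + \<beta>"
  define q where "q = a\<^sup>2 * d"
  define t where "t = 1 + a\<^sup>2"
  define t' where "t' = 1 + \<beta>\<^sup>2"
  define Q where "Q = {X * x + W * y | x y. x \<in> A \<and> y \<in> A}"
  have A_power: "x ^ k \<in> A" if "x \<in> A" for x k
    using that by (induction k) (auto intro: A_mult A_mem)
  have A_zero: "0 \<in> A"
    using A_add[OF A_mem(1) A_mem(1)] by (simp add: char2)
  have \<beta>A: "\<beta> \<in> A"
    unfolding \<beta>_def by (intro A_add A_mult A_mem)
  have wA: "w \<in> A"
    unfolding w_def by (intro A_add A_mult A_power A_mem)
  have XA: "X \<in> A" "W \<in> A" "X \<in> S" "W \<in> S"
    unfolding X_def W_def by (intro A_add S_add A_mem S_mem \<beta>A)+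
  have XX: "X * X = t" "W * W = t'" "X * W + W * X = q"
    unfolding X_def W_def t_def t'_def q_def a_\<beta>_anticommutator[symmetric]
    by (simp_all add: distrib_left distrib_right add_ac char2 char2' power2_eq_square)
  have tA: "t \<in> A" "t' \<in> A" "q \<in> A" and tS: "t \<in> S" "t' \<in> S" "q \<in> S"
    unfolding XX[symmetric] by (intro A_add A_mult S_add S_mult XA)+
  have Xt: "t * X = X * t" "t' * X = X * t'" "t * W = W * t" "t' * W = W * t'"
    by (simp_all add: t_def t'_def X_def W_def distrib_left distrib_right a_\<beta>_square a_square_\<beta>
        power_commutes add_ac)
  have qX: "q * X = X * q" "q * W = W * q"
    using Xt unfolding XX[symmetric] by (simp_all add: distrib_left distrib_right mult.assoc add_ac)
  have comm_square: "v * (x * x) = x * x * v" if "v * x = x * v" for v x :: 'r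
    by (metis that mult.assoc)
  have tt: "t' * t = t * t'" "q * t = t * q" "q * t' = t' * q"
    using comm_square[OF Xt(2)] comm_square[OF qX(1)] comm_square[OF qX(2)] unfolding XX .
  have Q_add: "x + y \<in> Q" if xy: "x \<in> Q" "y \<in> Q" for x y
  proof -
    obtain x1 x2 y1 y2 where *: "x1 \<in> A" "x2 \<in> A" "y1 \<in> A" "y2 \<in> A"
      "x = X * x1 + W * x2" "y = X * y1 + W * y2"
      using xy unfolding Q_def by blast
    then have "x + y = X * (x1 + y1) + W * (x2 + y2)"
      by (simp add: distrib_left add_ac)
    then show ?thesis
      unfolding Q_def using * A_add by blast
  qed
  have Q_mult: "x * y \<in> Q" if xy: "x \<in> Q" "y \<in> A" for x y
  proof -
    obtain x1 x2 where *: "x1 \<in> A" "x2 \<in> A" "x = X * x1 + W * x2"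
      using xy unfolding Q_def by blast
    then have "x * y = X * (x1 * y) + W * (x2 * y)"
      by (simp add: distrib_right mult.assoc)
    then show ?thesis
      unfolding Q_def using * xy(2) A_mult by blast
  qed
  have XQ: "X \<in> Q" "W \<in> Q"
    unfolding Q_def using A_mem(1) A_zero by force+
  have cQ: "1 + c \<in> Q"
  proof -
    have "q \<in> Q"
      unfolding XX(3)[symmetric] by (intro Q_add Q_mult XQ XA)
    \<comment> \<open>Since \<open>q = a^2 (1 + c) w\<close> and \<open>a\<close> commutes with
      \<open>d\<close>, the factor \<open>a ^ (2 ^ n - 2)\<close> cancels \<open>a^2\<close>. Then
      \<open>w ^ 3\<close> completes \<open>w\<close> to \<open>b ^ 4\<close>, whose inverse is
      \<open>b ^ (2 ^ m - 4)\<close>.\<close>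
    then have "q * (a ^ (2 ^ n - 2) * w ^ 3 * b ^ (2 ^ m - 4)) \<in> Q"
      by (intro Q_mult A_mult A_power A_mem wA)
    also have "q * (a ^ (2 ^ n - 2) * w ^ 3 * b ^ (2 ^ m - 4)) = 1 + c"
    proof -
      have n2: "(2::nat) \<le> 2 ^ n"
        using m_gt n_gt self_le_power[of "2::nat" n] by simp
      have "a\<^sup>2 * d * a ^ (2 ^ n - 2) = a\<^sup>2 * a ^ (2 ^ n - 2) * d"
        by (simp only: mult.assoc flip: power_commuting_commutes[OF a_d_commute])
      also have "a\<^sup>2 * a ^ (2 ^ n - 2) = a ^ 2 ^ n"
        using n2 by (simp only: le_add_diff_inverse flip: power_add)
      finally have 1: "a\<^sup>2 * d * a ^ (2 ^ n - 2) = d"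
        by (simp add: a_power)
      have 2: "w * w ^ 3 = b ^ 4"
        using w_power by (simp add: eval_nat_numeral mult.assoc)
      have "(4::nat) \<le> 2 ^ m"
        using m_gt power_increasing[of 2 m "2::nat"] by simp
      then have 3: "b ^ 4 * b ^ (2 ^ m - 4) = 1"
        by (simp only: le_add_diff_inverse b_power flip: power_add)
      have "q * (a ^ (2 ^ n - 2) * w ^ 3 * b ^ (2 ^ m - 4)) = d * w ^ 3 * b ^ (2 ^ m - 4)"
        unfolding q_def by (simp add: 1 flip: mult.assoc)
      also have "\<dots> = (1 + c) * (w * w ^ 3 * b ^ (2 ^ m - 4))"
        unfolding d_factor by (simp add: mult.assoc)
      finally show ?thesis
        by (simp add: 2 3)
    qed
    finally show ?thesis .
  qed
  have bQ: "1 + b \<in> Q"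
  proof -
    \<comment> \<open>Adding \<open>X v\<close> replaces \<open>a v\<close> by \<open>v\<close> and
      leaves \<open>1 + u + v\<close>. Setting \<open>c = 1\<close> turns \<open>u + v\<close> into
      \<open>b^2 + b + b^2 = b\<close>, so \<open>u + v + b\<close> is a multiple of
      \<open>1 + c\<close>; this multiple is the third summand.\<close>
    have "W + X * ((b + b\<^sup>2) * c\<^sup>2) + (1 + c) * (b\<^sup>2 * c + b * (1 + c)) \<in> Q"
      by (intro Q_add Q_mult XQ cQ A_add A_mult A_power A_mem)
    also have "W + X * ((b + b\<^sup>2) * c\<^sup>2) + (1 + c) * (b\<^sup>2 * c + b * (1 + c)) = 1 + b"
      unfolding W_def X_def by (simp add: expand)
    finally show ?thesis .
  qed
  have one: "\<exists>s\<in>S. \<exists>x\<in>A. \<exists>y\<in>A. h = s + (X * x + W * y)" if "h \<in> A" for h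
    using cover[OF Q_add Q_mult _ bQ cQ] XQ(1) that unfolding X_def[symmetric] Q_def by blast
  have A_cover: "\<exists>s\<in>S. \<exists>x\<in>A. \<exists>y\<in>A. \<exists>z\<in>A. h = s + t * x + t' * y + q * z" if hA: "h \<in> A" for h
  proof -
    obtain s x y where h: "s \<in> S" "x \<in> A" "y \<in> A" "h = s + (X * x + W * y)"
      using one[OF hA] by blast
    obtain s1 x1 y1 where 1: "s1 \<in> S" "x1 \<in> A" "y1 \<in> A" "x = s1 + (X * x1 + W * y1)"
      using one[OF h(2)] by blast
    obtain s2 x2 y2 where 2: "s2 \<in> S" "x2 \<in> A" "y2 \<in> A" "y = s2 + (X * x2 + W * y2)"
      using one[OF h(3)] by blast
    \<comment> \<open>After \<open>W X\<close> is replaced by \<open>q + X W\<close>, the only mixed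
      word left is \<open>X W\<close>, with coefficient \<open>y1 + x2\<close>. Expanding this
      coefficient once more yields \<open>X W X = q X + t W\<close> and \<open>X W W = t' X\<close>,
      which begin with \<open>t\<close>, \<open>t'\<close> or \<open>q\<close>.\<close>
    obtain s3 x3 y3 where 3: "s3 \<in> S" "x3 \<in> A" "y3 \<in> A" "y1 + x2 = s3 + (X * x3 + W * y3)"
      using one[OF A_add[OF 1(3) 2(2)]] by blast
    have WX: "W * X = q + X * W"
      by (simp add: char2 char2' add_ac flip: XX(3))
    have "X * W * X = q * X + t * W"
      by (simp add: mult.assoc WX distrib_left qX flip: XX(1))
    moreover have "X * W * W = t' * X"
      by (simp add: mult.assoc XX Xt)
    ultimately have XW: "X * W * (y1 + x2) = X * W * s3 + q * (X * x3) + t * (W * x3) + t' * (X * y3)"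
      unfolding 3(4) distrib_left by (simp add: distrib_right add_ac flip: mult.assoc)
    have "h = s + X * s1 + W * s2 + X * X * x1 + W * W * y2 + X * W * y1 + W * X * x2"
      unfolding h(4) 1(4) 2(4) by (simp add: distrib_left add_ac mult.assoc)
    also have "\<dots> = s + X * s1 + W * s2 + t * x1 + t' * y2 + q * x2 + X * W * (y1 + x2)"
      unfolding XX WX by (simp add: distrib_left distrib_right add_ac)
    also have "\<dots> = (s + X * s1 + W * s2 + X * W * s3) + t * (x1 + W * x3) + t' * (y2 + X * y3) + q * (x2 + X * x3)"
      unfolding XW by (simp add: distrib_left add_ac)
    finally have eq: "h = \<dots>" .
    have "s + X * s1 + W * s2 + X * W * s3 \<in> S"
      by (intro S_add S_mult XA h 1 2 3)
    moreover have "x1 + W * x3 \<in> A" "y2 + X * y3 \<in> A" "x2 + X * x3 \<in> A"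
      by (intro A_add A_mult XA 1 2 3)+
    ultimately show ?thesis
      using eq by blast
  qed
  \<comment> \<open>The summands of \<open>S + t A + t' A + q A\<close> are absorbed one at a time,
    first \<open>t A\<close>, then \<open>t' A\<close>, then \<open>q A\<close>. The commutation of
    \<open>t\<close>, \<open>t'\<close> and \<open>q\<close> keeps the intermediate sets closed
    under the left multiplications that the absorption lemma requires.\<close>
  define S1 where "S1 = {s + q * z | s z. s \<in> S \<and> z \<in> A}"
  define S2 where "S2 = {s + t' * y | s y. s \<in> S1 \<and> y \<in> A}"
  have extend_add: "x + y \<in> {s + p * z | s z. s \<in> T \<and> z \<in> A}"
    if "\<And>x y. x \<in> T \<Longrightarrow> y \<in> T \<Longrightarrow> x + y \<in> T"
      "x \<in> {s + p * z | s z. s \<in> T \<and> z \<in> A}" "y \<in> {s + p * z | s z. s \<in> T \<and> z \<in> A}" for T p x y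
  proof -
    obtain s z s' z' where "s \<in> T" "z \<in> A" "s' \<in> T" "z' \<in> A" "x = s + p * z" "y = s' + p * z'"
      using \<open>x \<in> _\<close> \<open>y \<in> _\<close> by blast
    then have "x + y = (s + s') + p * (z + z')" "s + s' \<in> T" "z + z' \<in> A"
      by (auto simp: distrib_left add_ac intro: A_add that(1))
    then show ?thesis by blast
  qed
  have extend_mult: "v * x \<in> {s + p * z | s z. s \<in> T \<and> z \<in> A}"
    if "\<And>x. x \<in> T \<Longrightarrow> v * x \<in> T" "v \<in> A" "p * v = v * p"
      "x \<in> {s + p * z | s z. s \<in> T \<and> z \<in> A}" for T p v x
  proof -
    obtain s z where sz: "s \<in> T" "z \<in> A" "x = s + p * z"
      using \<open>x \<in> _\<close> by blast
    then have "v * x = v * s + p * (v * z)"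
      by (simp add: distrib_left that(3) flip: mult.assoc)
    then show ?thesis using that(1,2) sz A_mult by blast
  qed
  have S1_add: "x + y \<in> S1" if "x \<in> S1" "y \<in> S1" for x y
    unfolding S1_def by (rule extend_add) (use that in \<open>simp_all only: S_add S1_def\<close>)
  have S2_add: "x + y \<in> S2" if "x \<in> S2" "y \<in> S2" for x y
    unfolding S2_def by (rule extend_add) (use that in \<open>simp_all only: S1_add S2_def\<close>)
  have S1_mult: "v * x \<in> S1" if "v \<in> S" "v \<in> A" "q * v = v * q" "x \<in> S1" for v x
    unfolding S1_def by (rule extend_mult) (use that in \<open>simp_all only: S_mult S1_def\<close>)
  have S2_mult: "t * x \<in> S2" if "x \<in> S2" for x
    unfolding S2_def
    by (rule extend_mult) (use that in \<open>simp_all only: S1_mult tS tA tt S2_def\<close>)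
  have "A \<subseteq> S2"
  proof (rule nilpotent_absorption[where t = t])
    show "\<exists>s\<in>S2. \<exists>y\<in>A. x = s + t * y" if "x \<in> A" for x
    proof -
      obtain s x' y z where 1: "s \<in> S" "x' \<in> A" "y \<in> A" "z \<in> A" "x = s + t * x' + t' * y + q * z"
        using A_cover[OF \<open>x \<in> A\<close>] by blast
      then have "x = ((s + q * z) + t' * y) + t * x'"
        by (simp add: add_ac)
      moreover have "(s + q * z) + t' * y \<in> S2"
        unfolding S2_def S1_def using 1 by blast
      ultimately show ?thesis using 1(2) by blast
    qed
    have "t ^ 2 ^ (n - 1) = 1 + (a\<^sup>2) ^ 2 ^ (n - 1)"
      unfolding t_def by (subst char2_power_two_power) (simp_all add: char2)
    also have "(a\<^sup>2) ^ 2 ^ (n - 1) = a ^ 2 ^ n"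
      using n_gt by (simp flip: power_mult power_Suc)
    finally show "t ^ 2 ^ (n - 1) = 0"
      by (simp add: a_power char2)
  qed (fact S2_add S2_mult)+
  have "A \<subseteq> S1"
  proof (rule nilpotent_absorption[where t = t'])
    show "\<exists>s\<in>S1. \<exists>y\<in>A. x = s + t' * y" if "x \<in> A" for x
      using \<open>A \<subseteq> S2\<close> that unfolding S2_def by blast
    show "t' * x \<in> S1" if "x \<in> S1" for x
      by (rule S1_mult[OF tS(2) tA(2) tt(3) that])
    have "t' ^ 2 ^ (m - 1) = 1 + (\<beta>\<^sup>2) ^ 2 ^ (m - 1)"
      unfolding t'_def by (subst char2_power_two_power) (simp_all add: char2)
    also have "(\<beta>\<^sup>2) ^ 2 ^ (m - 1) = \<beta> ^ 2 ^ m"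
      using m_gt by (simp flip: power_mult power_Suc)
    finally show "t' ^ 2 ^ (m - 1) = 0"
      by (simp add: \<beta>_power char2)
  qed (fact S1_add)
  show "A \<subseteq> S"
  proof (rule nilpotent_absorption[where t = q])
    show "\<exists>s\<in>S. \<exists>y\<in>A. x = s + q * y" if "x \<in> A" for x
      using \<open>A \<subseteq> S1\<close> that unfolding S1_def by blast
    show "q ^ 4 = 0" unfolding q_def by (rule q_power)
  qed (fact S_add S_mult[OF tS(3)])+
qed

end

subsection \<open>The presented groups\<close>

text \<open>A collection process: \<open>z\<close> passes \<open>x\<close> or \<open>y\<close> by
  turning into a power of \<open>z\<close>, and \<open>y\<close> passes \<open>x\<close> by emitting
  a \<open>z\<close>, so left multiplication by each letter preserves \<open>T\<close>. The
  exponents \<open>e\<close> and \<open>f\<close> are left open to serve both groups: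
  \<open>e = f = 3\<close> for \<open>G\<close>, and \<open>e = 3\<close>, \<open>f = 1\<close> for
  \<open>H\<close>.\<close>

lemma (in monoid) triangular_word_closed:
  fixes x y z
  defines "T \<equiv> {x [^] (i::nat) \<otimes> y [^] (j::nat) \<otimes> z [^] (l::nat) | i j l. True}"
  assumes [simp]: "x \<in> carrier G" "y \<in> carrier G" "z \<in> carrier G"
    and yx: "y \<otimes> x = x \<otimes> y \<otimes> z"
    and zx: "z \<otimes> x = x \<otimes> z [^] (e::nat)" and zy: "z \<otimes> y = y \<otimes> z [^] (f::nat)"
    and "t \<in> T" "t' \<in> T"
  shows "t \<otimes> t' \<in> T"
proof -
  have skew: "\<exists>l'. z [^] (l::nat) \<otimes> v [^] (i::nat) = v [^] i \<otimes> z [^] (l'::nat)"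
    if [simp]: "v \<in> carrier G" and zv: "z \<otimes> v = v \<otimes> z [^] (k::nat)" for v k l i
  proof (induction i arbitrary: l)
    case (Suc i)
    have step: "z [^] l \<otimes> v = v \<otimes> z [^] (k * l)" for l :: nat
    proof (induction l)
      case (Suc l)
      have "z [^] Suc l \<otimes> v = z [^] l \<otimes> (z \<otimes> v)"
        by (simp add: m_assoc)
      also have "\<dots> = z [^] l \<otimes> v \<otimes> z [^] k"
        by (simp add: zv m_assoc)
      also have "\<dots> = v \<otimes> (z [^] (k * l) \<otimes> z [^] k)"
        by (simp add: Suc m_assoc)
      finally show ?case by (simp add: nat_pow_mult add.commute)
    qed simp
    obtain l' where l': "z [^] l \<otimes> v [^] i = v [^] i \<otimes> z [^] (l'::nat)"
      using Suc by blast
    have "z [^] l \<otimes> v [^] Suc i = v [^] i \<otimes> (z [^] l' \<otimes> v)"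
      by (simp add: l' flip: m_assoc)
    also have "\<dots> = v [^] Suc i \<otimes> z [^] (k * l')"
      by (simp add: step m_assoc)
    finally show ?case by blast
  qed auto
  have y_move: "\<exists>l. y \<otimes> x [^] (i::nat) = x [^] i \<otimes> y \<otimes> z [^] (l::nat)" for i
  proof (induction i)
    case 0
    have "y \<otimes> x [^] (0::nat) = x [^] (0::nat) \<otimes> y \<otimes> z [^] (0::nat)" by simp
    then show ?case by blast
  next
    case (Suc i)
    then obtain l :: nat where l: "y \<otimes> x [^] i = x [^] i \<otimes> y \<otimes> z [^] l" by blast
    obtain l' :: nat where l': "z [^] l \<otimes> x = x \<otimes> z [^] l'"
      using skew[OF _ zx, of l 1] by auto
    have "y \<otimes> x [^] Suc i = (y \<otimes> x [^] i) \<otimes> x"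
      by (simp add: m_assoc)
    also have "\<dots> = x [^] i \<otimes> y \<otimes> (z [^] l \<otimes> x)"
      by (simp add: l m_assoc)
    also have "\<dots> = x [^] i \<otimes> (y \<otimes> x) \<otimes> z [^] l'"
      by (simp add: l' m_assoc)
    also have "\<dots> = x [^] Suc i \<otimes> y \<otimes> (z \<otimes> z [^] l')"
      by (simp add: yx m_assoc)
    finally show ?case
      by (metis assms(4) nat_pow_Suc2)
  qed
  have T_carrier: "t \<in> carrier G" if "t \<in> T" for t
    using that by (auto simp: T_def)
  have x_left: "x \<otimes> t \<in> T" if "t \<in> T" for t
  proof -
    obtain i j l :: nat where "t = x [^] i \<otimes> y [^] j \<otimes> z [^] l"
      using \<open>t \<in> T\<close> unfolding T_def by blast
    then have "x \<otimes> t = x [^] Suc i \<otimes> y [^] j \<otimes> z [^] l"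
      unfolding nat_pow_Suc2[OF assms(2)] by (simp add: m_assoc)
    then show ?thesis unfolding T_def by blast
  qed
  have z_left: "z \<otimes> t \<in> T" if "t \<in> T" for t
  proof -
    obtain i j l :: nat where t: "t = x [^] i \<otimes> y [^] j \<otimes> z [^] l"
      using \<open>t \<in> T\<close> unfolding T_def by blast
    obtain k :: nat where k: "z \<otimes> x [^] i = x [^] i \<otimes> z [^] k"
      using skew[OF _ zx, of 1 i] by auto
    obtain k' :: nat where k': "z [^] k \<otimes> y [^] j = y [^] j \<otimes> z [^] k'"
      using skew[OF _ zy, of k j] by auto
    have "z \<otimes> t = (z \<otimes> x [^] i) \<otimes> y [^] j \<otimes> z [^] l"
      by (simp add: t m_assoc)
    also have "\<dots> = x [^] i \<otimes> (z [^] k \<otimes> y [^] j) \<otimes> z [^] l"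
      by (simp add: k m_assoc)
    also have "\<dots> = x [^] i \<otimes> y [^] j \<otimes> z [^] (k' + l)"
      by (simp add: k' m_assoc nat_pow_mult)
    finally show ?thesis unfolding T_def by blast
  qed
  have y_left: "y \<otimes> t \<in> T" if "t \<in> T" for t
  proof -
    obtain i j l :: nat where t: "t = x [^] i \<otimes> y [^] j \<otimes> z [^] l"
      using \<open>t \<in> T\<close> unfolding T_def by blast
    obtain k :: nat where k: "y \<otimes> x [^] i = x [^] i \<otimes> y \<otimes> z [^] k"
      using y_move by blast
    obtain k' :: nat where k': "z [^] k \<otimes> y [^] j = y [^] j \<otimes> z [^] k'"
      using skew[OF _ zy, of k j] by auto
    have "y \<otimes> t = (y \<otimes> x [^] i) \<otimes> y [^] j \<otimes> z [^] l"
      by (simp add: t m_assoc)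
    also have "\<dots> = x [^] i \<otimes> y \<otimes> (z [^] k \<otimes> y [^] j) \<otimes> z [^] l"
      by (simp add: k m_assoc)
    also have "\<dots> = x [^] i \<otimes> (y \<otimes> y [^] j) \<otimes> z [^] (k' + l)"
      by (simp add: k' m_assoc nat_pow_mult)
    also have "\<dots> = x [^] i \<otimes> y [^] Suc j \<otimes> z [^] (k' + l)"
      by (simp only: nat_pow_Suc2[OF assms(3)])
    finally show ?thesis unfolding T_def by blast
  qed
  have power_left: "v [^] (k::nat) \<otimes> t \<in> T"
    if [simp]: "v \<in> carrier G" and "\<And>t. t \<in> T \<Longrightarrow> v \<otimes> t \<in> T" "t \<in> T" for v k t
    using that(3)
  proof (induction k arbitrary: t)
    case (Suc k)
    then show ?case
      using that(2)[OF Suc.prems] T_carrier by (simp add: m_assoc)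
  qed (simp add: T_carrier)
  obtain i j l :: nat where t: "t = x [^] i \<otimes> y [^] j \<otimes> z [^] l"
    using \<open>t \<in> T\<close> unfolding T_def by blast
  have "t \<otimes> t' = x [^] i \<otimes> (y [^] j \<otimes> (z [^] l \<otimes> t'))"
    by (simp add: t m_assoc T_carrier[OF \<open>t' \<in> T\<close>])
  also have "\<dots> \<in> T"
    by (intro power_left x_left y_left z_left \<open>t' \<in> T\<close>) simp_all
  finally show ?thesis .
qed

text \<open>Because the generators have finite order, their inverses are nonnegative powers. The
  generated subgroup therefore consists of the words \<open>x^i y^j z^l\<close>, and the exponents
  may be reduced modulo \<open>N\<close>, \<open>M\<close> and \<open>P\<close>.\<close>

lemma (in group) generate_triangular:
  fixes N M P :: nat
  assumes xyz [simp]: "x \<in> carrier G" "y \<in> carrier G" "z \<in> carrier G"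
    and rels: "y \<otimes> x = x \<otimes> y \<otimes> z" "z \<otimes> x = x \<otimes> z [^] (e::nat)" "z \<otimes> y = y \<otimes> z [^] (f::nat)"
    and N: "0 < N" "x [^] N = \<one>" and M: "0 < M" "y [^] M = \<one>" and P: "0 < P" "z [^] P = \<one>"
  shows "finite (generate G {x, y, z})" "card (generate G {x, y, z}) \<le> N * M * P"
proof -
  let ?w = "\<lambda>i j l. x [^] (i::nat) \<otimes> y [^] (j::nat) \<otimes> z [^] (l::nat)"
  let ?B = "(\<lambda>(i, j, l). ?w i j l) ` ({..<N} \<times> {..<M} \<times> {..<P})"
  have pow_mod: "v [^] i = v [^] (i mod k)" if "v \<in> carrier G" "v [^] k = \<one>" for v and i k :: nat
  proof -
    have "v [^] i = v [^] (k * (i div k) + i mod k)" by simp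
    also have "\<dots> = v [^] (i mod k)"
      using that by (simp only: nat_pow_mult[symmetric] nat_pow_pow[symmetric]) simp
    finally show ?thesis .
  qed
  have pow_inv: "inv v = v [^] (k - 1)" if "v \<in> carrier G" "0 < k" "v [^] k = \<one>" for v and k :: nat
  proof (rule inv_equality)
    show "v [^] (k - 1) \<otimes> v = \<one>"
      using that by (metis Suc_diff_1 nat_pow_Suc)
  qed (use that in auto)
  have gen: "\<exists>i j l. g = ?w i j l" if "g \<in> generate G {x, y, z}" for g
    using that
  proof induction
    case one
    have "\<one> = ?w 0 0 0" by simp
    then show ?case by blast
  next
    case (incl h)
    have "x = ?w 1 0 0" "y = ?w 0 1 0" "z = ?w 0 0 1" by simp_all
    then show ?case using incl by blast
  next
    case (inv h)
    have "inv x = ?w (N - 1) 0 0" "inv y = ?w 0 (M - 1) 0" "inv z = ?w 0 0 (P - 1)"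
      using pow_inv N M P by simp_all
    then show ?case using inv by blast
  next
    case (eng h1 h2)
    then show ?case
      using triangular_word_closed[OF xyz rels, of h1 h2] by blast
  qed
  have "generate G {x, y, z} \<subseteq> ?B"
  proof
    fix g assume "g \<in> generate G {x, y, z}"
    then obtain i j l where "g = ?w i j l" using gen by blast
    also have "\<dots> = ?w (i mod N) (j mod M) (l mod P)"
      using pow_mod[of x N i] pow_mod[of y M j] pow_mod[of z P l] N M P by simp
    finally show "g \<in> ?B"
      using N M P by (intro image_eqI[where x = "(i mod N, j mod M, l mod P)"]) auto
  qed
  moreover have "finite ?B" by simp
  moreover have "card ?B \<le> N * M * P"
    by (rule order_trans[OF card_image_le]) (simp_all add: card_cartesian_product)
  ultimately show "finite (generate G {x, y, z})" "card (generate G {x, y, z}) \<le> N * M * P"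
    by (meson finite_subset card_mono order_trans)+
qed

lemma (in group) commutator_relation:
  assumes "x \<in> carrier G" "y \<in> carrier G"
  shows "y \<otimes> x = x \<otimes> y \<otimes> comm G y x"
  using assms by (simp add: comm_def m_assoc inv_solve_left flip: m_assoc[of y "inv y"] m_assoc[of x "inv x"])

lemma (in group) conj_relation:
  assumes "x \<in> carrier G" "z \<in> carrier G"
  shows "z \<otimes> x = x \<otimes> conj G z x"
  using assms by (simp add: conj_def flip: m_assoc)

lemma (in group) inv_fourth_root_of_unity:
  assumes "z \<in> carrier G" "z [^] (4::nat) = \<one>"
  shows "inv z = z [^] (3::nat)"
  using assms by (intro inv_equality) (simp_all add: numeral_eq_Suc)

lemma (in group) G_rel_generate:
  assumes "G_rel G n m x y z"
  shows "finite (generate G {x, y, z})" "card (generate G {x, y, z}) \<le> 2 ^ n * 2 ^ m * 4"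
proof -
  have xyz: "x \<in> carrier G" "y \<in> carrier G" "z \<in> carrier G"
    using assms by (auto simp: G_rel_def)
  have rels: "comm G y x = z" "conj G z x = inv z" "conj G z y = inv z" "z [^] (4::nat) = \<one>"
    "x [^] ((2::nat) ^ n) = \<one>" "y [^] ((2::nat) ^ m) = \<one>"
    using assms unfolding G_rel_def by blast+
  have "y \<otimes> x = x \<otimes> y \<otimes> z" "z \<otimes> x = x \<otimes> z [^] (3::nat)" "z \<otimes> y = y \<otimes> z [^] (3::nat)"
    using commutator_relation[OF xyz(1,2)] conj_relation[OF xyz(1,3)] conj_relation[OF xyz(2,3)]
    unfolding rels inv_fourth_root_of_unity[OF xyz(3) rels(4)] .
  from generate_triangular[OF xyz this _ rels(5) _ rels(6) _ rels(4)]
  show "finite (generate G {x, y, z})" "card (generate G {x, y, z}) \<le> 2 ^ n * 2 ^ m * 4"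
    by simp_all
qed

lemma (in group) H_rel_relations:
  assumes "H_rel G n m a b c"
  shows "b \<otimes> a = a \<otimes> b \<otimes> c" "c \<otimes> a = a \<otimes> c [^] (3::nat)" "c \<otimes> b = b \<otimes> c"
proof -
  have abc: "a \<in> carrier G" "b \<in> carrier G" "c \<in> carrier G"
    using assms by (auto simp: H_rel_def)
  have rels: "comm G b a = c" "conj G c a = inv c" "conj G c b = c" "c [^] (4::nat) = \<one>"
    using assms unfolding H_rel_def by blast+
  show "b \<otimes> a = a \<otimes> b \<otimes> c" "c \<otimes> a = a \<otimes> c [^] (3::nat)" "c \<otimes> b = b \<otimes> c"
    using commutator_relation[OF abc(1,2)] conj_relation[OF abc(1,3)] conj_relation[OF abc(2,3)]
    unfolding rels inv_fourth_root_of_unity[OF abc(3) rels(4)] .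
qed

lemma (in group) H_rel_generate_finite:
  assumes "H_rel G n m a b c"
  shows "finite (generate G {a, b, c})"
proof -
  have abc: "a \<in> carrier G" "b \<in> carrier G" "c \<in> carrier G"
    using assms by (auto simp: H_rel_def)
  have "c \<otimes> b = b \<otimes> c [^] (1::nat)"
    using H_rel_relations(3)[OF assms] abc by simp
  moreover have "a [^] ((2::nat) ^ n) = \<one>" "b [^] ((2::nat) ^ m) = \<one>" "c [^] (4::nat) = \<one>"
    using assms unfolding H_rel_def by blast+
  ultimately show ?thesis
    using generate_triangular(1)[OF abc H_rel_relations(1,2)[OF assms], of 1 "2 ^ n" "2 ^ m" 4] by simp
qed

section \<open>Relations under homomorphisms and the universal properties\<close>

lemma (in group_hom) hom_comm:
  "g \<in> carrier G \<Longrightarrow> k \<in> carrier G \<Longrightarrow> h (comm G g k) = comm H (h g) (h k)"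
  by (simp add: comm_def)

lemma (in group_hom) hom_conj:
  "g \<in> carrier G \<Longrightarrow> k \<in> carrier G \<Longrightarrow> h (conj G g k) = conj H (h g) (h k)"
  by (simp add: conj_def)

lemma (in group_hom) G_rel_image: "G_rel G n m x y z \<Longrightarrow> G_rel H n m (h x) (h y) (h z)"
  unfolding G_rel_def
  by (auto simp flip: hom_comm hom_conj hom_nat_pow hom_inv)

lemma (in group_hom) H_rel_image: "H_rel G n m x y z \<Longrightarrow> H_rel H n m (h x) (h y) (h z)"
  unfolding H_rel_def
  by (auto simp flip: hom_comm hom_conj hom_nat_pow hom_inv)

lemma (in group) nat_copy:
  assumes "finite (carrier G)"
  obtains L :: "nat monoid" and f where "group L" "f \<in> iso G L"
proof -
  obtain f :: "_ \<Rightarrow> nat" where "inj_on f (carrier G)"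
    using finite_imp_inj_to_nat_seg[OF assms] by blast
  then show thesis
    using that inj_imp_image_group_is_group inj_imp_image_group_iso by blast
qed

text \<open>The universal property in the definition tests only groups on \<open>nat\<close>. A
  finite group of any type is copied to \<open>nat\<close>, and the homomorphism found there is
  composed with the inverse of the copying isomorphism.\<close>

lemma G_presented_hom:
  assumes pres: "is_G_presented K n m x y z" and "group L" "finite (carrier L)"
    and rel: "G_rel L n m x' y' z'"
  obtains \<phi> where "\<phi> \<in> hom K L" "\<phi> x = x'" "\<phi> y = y'" "\<phi> z = z'"
proof -
  interpret L: group L by fact
  have carrier: "x' \<in> carrier L" "y' \<in> carrier L" "z' \<in> carrier L"
    using rel unfolding G_rel_def by blast+
  obtain N :: "nat monoid" and f where N: "group N" and f: "f \<in> iso L N"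
    using L.nat_copy[OF assms(3)] by blast
  interpret N: group N by fact
  interpret f: group_hom L N f
    using f by unfold_locales (simp add: iso_def)
  have "G_rel N n m (f x') (f y') (f z')"
    using rel by (rule f.G_rel_image)
  then obtain \<psi> where \<psi>: "\<psi> \<in> hom K N" "\<psi> x = f x'" "\<psi> y = f y'" "\<psi> z = f z'"
    using pres N unfolding is_G_presented_def by blast
  let ?g = "inv_into (carrier L) f"
  have "?g \<in> hom N L"
    using L.iso_set_sym[OF f] by (simp add: iso_def)
  then have "?g \<circ> \<psi> \<in> hom K L"
    by (rule hom_compose[OF \<psi>(1)])
  moreover have "?g (f t) = t" if "t \<in> carrier L" for t
    using that f by (simp add: iso_def bij_betw_def)
  ultimately show thesis
    using that[of "?g \<circ> \<psi>"] \<psi> carrier by simp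
qed

lemma H_presented_hom:
  assumes pres: "is_H_presented K n m x y z" and "group L" "finite (carrier L)"
    and rel: "H_rel L n m x' y' z'"
  obtains \<phi> where "\<phi> \<in> hom K L" "\<phi> x = x'" "\<phi> y = y'" "\<phi> z = z'"
proof -
  interpret L: group L by fact
  have carrier: "x' \<in> carrier L" "y' \<in> carrier L" "z' \<in> carrier L"
    using rel unfolding H_rel_def by blast+
  obtain N :: "nat monoid" and f where N: "group N" and f: "f \<in> iso L N"
    using L.nat_copy[OF assms(3)] by blast
  interpret N: group N by fact
  interpret f: group_hom L N f
    using f by unfold_locales (simp add: iso_def)
  have "H_rel N n m (f x') (f y') (f z')"
    using rel by (rule f.H_rel_image)
  then obtain \<psi> where \<psi>: "\<psi> \<in> hom K N" "\<psi> x = f x'" "\<psi> y = f y'" "\<psi> z = f z'"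
    using pres N unfolding is_H_presented_def by blast
  let ?g = "inv_into (carrier L) f"
  have "?g \<in> hom N L"
    using L.iso_set_sym[OF f] by (simp add: iso_def)
  then have "?g \<circ> \<psi> \<in> hom K L"
    by (rule hom_compose[OF \<psi>(1)])
  moreover have "?g (f t) = t" if "t \<in> carrier L" for t
    using that f by (simp add: iso_def bij_betw_def)
  ultimately show thesis
    using that[of "?g \<circ> \<psi>"] \<psi> carrier by simp
qed

text \<open>Since \<open>x^2\<close> commutes with \<open>y\<close> and \<open>y^2\<close> with
  \<open>x\<close>, conjugation by \<open>x\<close> or by \<open>y\<close> inverts
  \<open>[y, x]\<close>. Moreover \<open>[y, x]\<close> is \<open>(x y)^(-1) (y x)\<close> with
  commuting factors, so \<open>fourth\<close> makes its fourth power trivial.\<close>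

lemma (in group) G_rel_if_squares_central:
  assumes xy: "x \<in> carrier G" "y \<in> carrier G"
    and "x [^] ((2::nat) ^ n) = \<one>" "y [^] ((2::nat) ^ m) = \<one>"
    and xx: "y \<otimes> (x \<otimes> x) = x \<otimes> x \<otimes> y" and yy: "x \<otimes> (y \<otimes> y) = y \<otimes> y \<otimes> x"
    and fourth: "(x \<otimes> y) [^] (4::nat) = (y \<otimes> x) [^] (4::nat)"
  shows "G_rel G n m x y (comm G y x)"
proof -
  have cancel: "g \<otimes> (inv g \<otimes> u) = u" "inv g \<otimes> (g \<otimes> u) = u" if "g \<in> carrier G" "u \<in> carrier G" for g u
    using that by (simp_all flip: m_assoc)
  have inv_commute: "inv g \<otimes> u = u \<otimes> inv g" if "g \<otimes> u = u \<otimes> g" "g \<in> carrier G" "u \<in> carrier G" for g u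
  proof -
    have "inv g \<otimes> u = inv g \<otimes> (u \<otimes> g) \<otimes> inv g"
      using that(2,3) by (simp add: m_assoc)
    also have "\<dots> = u \<otimes> inv g"
      unfolding that(1)[symmetric] using that(2,3) by (simp add: cancel)
    finally show ?thesis .
  qed
  have z: "comm G y x = inv (x \<otimes> y) \<otimes> (y \<otimes> x)"
    using xy by (simp add: comm_def inv_mult_group m_assoc)
  have inv_z: "inv (comm G y x) = inv x \<otimes> inv y \<otimes> x \<otimes> y"
    using xy by (simp add: comm_def inv_mult_group m_assoc)
  have "conj G (comm G y x) x = inv x \<otimes> (inv y \<otimes> (inv x \<otimes> (y \<otimes> (x \<otimes> x))))"
    using xy by (simp add: comm_def conj_def m_assoc)
  also have "\<dots> = inv (comm G y x)"
    unfolding xx inv_z using xy by (simp add: m_assoc cancel)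
  finally have 1: "conj G (comm G y x) x = inv (comm G y x)" .
  have "conj G (comm G y x) y = inv y \<otimes> (inv y \<otimes> (inv x \<otimes> (y \<otimes> (x \<otimes> y))))"
    using xy by (simp add: comm_def conj_def m_assoc)
  \<comment> \<open>The inverse commutator is split off on the right, using that \<open>y^2\<close>
    commutes with \<open>x\<close>. What remains, \<open>x y^2\<close>, is cancelled by the factors
    in front.\<close>
  also have "y \<otimes> (x \<otimes> y) = x \<otimes> (y \<otimes> y) \<otimes> (inv x \<otimes> inv y \<otimes> x \<otimes> y)"
    unfolding yy using xy by (simp add: m_assoc cancel)
  also have "inv y \<otimes> (inv y \<otimes> (inv x \<otimes> \<dots>)) = inv (comm G y x)"
    unfolding inv_z using xy by (simp add: m_assoc cancel)
  finally have 2: "conj G (comm G y x) y = inv (comm G y x)" .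
  have "(x \<otimes> y) \<otimes> (y \<otimes> x) = x \<otimes> (y \<otimes> y) \<otimes> x"
    using xy by (simp add: m_assoc)
  also have "\<dots> = y \<otimes> (y \<otimes> (x \<otimes> x))"
    unfolding yy using xy by (simp add: m_assoc)
  also have "\<dots> = (y \<otimes> x) \<otimes> (x \<otimes> y)"
    unfolding xx using xy by (simp add: m_assoc)
  finally have "inv (x \<otimes> y) \<otimes> (y \<otimes> x) = (y \<otimes> x) \<otimes> inv (x \<otimes> y)"
    using xy by (intro inv_commute) auto
  then have "comm G y x [^] (4::nat) = inv (x \<otimes> y) [^] (4::nat) \<otimes> (y \<otimes> x) [^] (4::nat)"
    unfolding z using xy by (intro pow_mult_distrib) auto
  also have "\<dots> = \<one>"
    using xy by (simp add: nat_pow_inv flip: fourth)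
  finally have 3: "comm G y x [^] (4::nat) = \<one>" .
  show ?thesis
    unfolding G_rel_def using assms 1 2 3 by (simp add: comm_def)
qed

section \<open>An explicit model of \<open>H\<close> and a lower bound for the order of
  \<open>H\<close>\<close>

text \<open>The triple \<open>(i, j, l)\<close> stands for the normal form \<open>a\<^sup>i b\<^sup>j c\<^sup>l\<close>;
  moving \<open>b\<^sup>j c\<^sup>l\<close> past \<open>a\<close> turns it into \<open>b\<^sup>j c\<^bsup>j-l\<^esup>\<close>.\<close>

fun triple_mult :: "int \<times> int \<times> int \<Rightarrow> int \<times> int \<times> int \<Rightarrow> int \<times> int \<times> int" where
  "triple_mult (i, j, l) (i', j', l') = (i + i', j + j', (if even i' then l else j - l) + l')"

fun triple_mod :: "nat \<Rightarrow> nat \<Rightarrow> int \<times> int \<times> int \<Rightarrow> int \<times> int \<times> int" where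
  "triple_mod n m (i, j, l) = (i mod 2 ^ n, j mod 2 ^ m, l mod 4)"

text \<open>Products are formed with unreduced integer exponents, where associativity holds exactly,
  and reduced only afterwards. Integers avoid truncation in \<open>j - l\<close>.\<close>

definition H_model :: "nat \<Rightarrow> nat \<Rightarrow> (int \<times> int \<times> int) monoid" where
  "H_model n m = \<lparr>carrier = {0..<2 ^ n} \<times> {0..<2 ^ m} \<times> {0..<4},
     mult = (\<lambda>p q. triple_mod n m (triple_mult p q)), one = (0, 0, 0)\<rparr>"

lemma triple_mult_assoc: "triple_mult (triple_mult p q) r = triple_mult p (triple_mult q r)"
  by (cases p; cases q; cases r) auto

context
  fixes n m :: nat
  assumes n: "1 < n" and m: "1 < m"
begin

lemma four_dvd: "(4::int) dvd 2 ^ m"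
  using m le_imp_power_dvd[of 2 m "2::int"] by simp

lemma even_mod: "even (i mod 2 ^ n) \<longleftrightarrow> even (i::int)"
  using n by (simp add: dvd_mod_iff)

text \<open>Reduction is compatible with the product: the parity of the first exponent survives
  reduction modulo \<open>2 ^ n\<close>, and \<open>j - l\<close> is well defined modulo 4 because 4
  divides \<open>2 ^ m\<close>.\<close>

lemma triple_mod_mult:
  "triple_mod n m (triple_mult (triple_mod n m p) q) = triple_mod n m (triple_mult p q)"
  "triple_mod n m (triple_mult p (triple_mod n m q)) = triple_mod n m (triple_mult p q)"
proof -
  obtain i j l i' j' l' where [simp]: "p = (i, j, l)" "q = (i', j', l')"
    by (metis surj_pair)
  have [simp]: "(j mod 2 ^ m - l mod 4 + k) mod 4 = (j - l + k) mod 4" for k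
  proof -
    have "(j mod 2 ^ m - l mod 4 + k) mod 4 = ((j mod 2 ^ m) mod 4 - l mod 4 + k) mod 4"
      by (metis mod_add_left_eq mod_diff_left_eq)
    also have "\<dots> = (j - l + k) mod 4"
      by (metis mod_mod_cancel[OF four_dvd] mod_add_left_eq mod_diff_eq)
    finally show ?thesis .
  qed
  show "triple_mod n m (triple_mult (triple_mod n m p) q) = triple_mod n m (triple_mult p q)"
    by (simp add: mod_simps)
  show "triple_mod n m (triple_mult p (triple_mod n m q)) = triple_mod n m (triple_mult p q)"
    by (simp add: mod_simps even_mod)
qed

lemma triple_mod_id: "p \<in> carrier (H_model n m) \<Longrightarrow> triple_mod n m p = p"
  by (auto simp: H_model_def)

lemma triple_mod_carrier: "triple_mod n m p \<in> carrier (H_model n m)"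
  by (cases p) (auto simp: H_model_def)

lemma H_model_group: "group (H_model n m)"
proof (rule groupI)
  show "\<one>\<^bsub>H_model n m\<^esub> \<in> carrier (H_model n m)"
    by (simp add: H_model_def)
next
  fix p q r
  show "p \<otimes>\<^bsub>H_model n m\<^esub> q \<in> carrier (H_model n m)"
    using triple_mod_carrier by (simp add: H_model_def)
  show "p \<otimes>\<^bsub>H_model n m\<^esub> q \<otimes>\<^bsub>H_model n m\<^esub> r = p \<otimes>\<^bsub>H_model n m\<^esub> (q \<otimes>\<^bsub>H_model n m\<^esub> r)"
    by (simp add: H_model_def triple_mod_mult triple_mult_assoc)
  assume p: "p \<in> carrier (H_model n m)"
  obtain i j l where ijl: "p = (i, j, l)" by (metis surj_pair)
  show "\<one>\<^bsub>H_model n m\<^esub> \<otimes>\<^bsub>H_model n m\<^esub> p = p"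
    using p triple_mod_id[OF p] by (simp add: H_model_def ijl)
  \<comment> \<open>For odd \<open>i\<close>, moving past \<open>a^i\<close> turns the third
    exponent \<open>l'\<close> of the inverse into \<open>-j - l'\<close>. This must equal
    \<open>-l\<close>, so \<open>l' = l - j\<close>.\<close>
  let ?q = "(-i, -j, if even i then -l else l - j)"
  have "triple_mod n m ?q \<otimes>\<^bsub>H_model n m\<^esub> p = \<one>\<^bsub>H_model n m\<^esub>"
    by (simp add: H_model_def triple_mod_mult del: triple_mod.simps) (simp add: ijl)
  then show "\<exists>q\<in>carrier (H_model n m). q \<otimes>\<^bsub>H_model n m\<^esub> p = \<one>\<^bsub>H_model n m\<^esub>"
    using triple_mod_carrier by blast
qed

lemma H_model_pow:
  "(1, 0, 0) [^]\<^bsub>H_model n m\<^esub> (k::nat) = (int k mod 2 ^ n, 0, 0)"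
  "(0, 1, 0) [^]\<^bsub>H_model n m\<^esub> k = (0, int k mod 2 ^ m, 0)"
  "(0, 0, 1) [^]\<^bsub>H_model n m\<^esub> k = (0, 0, int k mod 4)"
  by (induction k) (simp_all add: H_model_def nat_pow_def mod_simps ac_simps)

lemma H_model_rel: "H_rel (H_model n m) n m (1, 0, 0) (0, 1, 0) (0, 0, 1)"
proof -
  let ?M = "H_model n m"
  let ?a = "(1, 0, 0) :: int \<times> int \<times> int" and ?b = "(0, 1, 0) :: int \<times> int \<times> int"
    and ?c = "(0, 0, 1) :: int \<times> int \<times> int"
  interpret M: group ?M by (rule H_model_group)
  have gt: "1 < (2::int) ^ n" "1 < (2::int) ^ m"
    using n m by (simp_all add: one_less_power)
  have abc: "?a \<in> carrier ?M" "?b \<in> carrier ?M" "?c \<in> carrier ?M"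
    using gt by (auto simp: H_model_def)
  have ba: "?b \<otimes>\<^bsub>?M\<^esub> ?a = ?a \<otimes>\<^bsub>?M\<^esub> ?b \<otimes>\<^bsub>?M\<^esub> ?c"
    and ca: "?c \<otimes>\<^bsub>?M\<^esub> ?a = ?a \<otimes>\<^bsub>?M\<^esub> ?c [^]\<^bsub>?M\<^esub> (3::nat)"
    and cb: "?c \<otimes>\<^bsub>?M\<^esub> ?b = ?b \<otimes>\<^bsub>?M\<^esub> ?c"
    unfolding H_model_pow using gt by (simp_all add: H_model_def)
  have pows: "?a [^]\<^bsub>?M\<^esub> ((2::nat) ^ n) = \<one>\<^bsub>?M\<^esub>" "?b [^]\<^bsub>?M\<^esub> ((2::nat) ^ m) = \<one>\<^bsub>?M\<^esub>"
    "?c [^]\<^bsub>?M\<^esub> (4::nat) = \<one>\<^bsub>?M\<^esub>"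
    unfolding H_model_pow by (simp_all add: H_model_def)
  have "comm ?M ?b ?a = ?c"
    using abc M.commutator_relation[OF abc(1,2)] ba
    by (simp add: comm_def)
  moreover have "conj ?M ?c ?a = inv\<^bsub>?M\<^esub> ?c" "conj ?M ?c ?b = ?c"
    using M.conj_relation[OF abc(1,3)] M.conj_relation[OF abc(2,3)] ca cb abc
      M.inv_fourth_root_of_unity[OF abc(3) pows(3)] by (simp_all add: conj_def)
  ultimately show ?thesis
    unfolding H_rel_def using abc pows by simp
qed

text \<open>The model satisfies the relations, so \<open>K\<close> maps to it. The map is onto
  because every triple is the image of a word in \<open>a\<close>, \<open>b\<close>,
  \<open>c\<close>.\<close>

lemma H_presented_card_ge:
  assumes pres: "is_H_presented K n m a b c"
  shows "finite (carrier K)" "2 ^ n * 2 ^ m * 4 \<le> card (carrier K)"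
proof -
  let ?M = "H_model n m"
  interpret K: group K using pres by (simp add: is_H_presented_def)
  interpret M: group ?M by (rule H_model_group)
  show fin: "finite (carrier K)"
    using K.H_rel_generate_finite pres unfolding is_H_presented_def by metis
  have "finite (carrier ?M)"
    by (simp add: H_model_def)
  then obtain \<phi> where \<phi>: "\<phi> \<in> hom K ?M" "\<phi> a = (1, 0, 0)" "\<phi> b = (0, 1, 0)" "\<phi> c = (0, 0, 1)"
    using H_presented_hom[OF pres H_model_group _ H_model_rel] by blast
  interpret \<phi>: group_hom K ?M \<phi> by unfold_locales (rule \<phi>(1))
  have abc: "a \<in> carrier K" "b \<in> carrier K" "c \<in> carrier K"
    using pres unfolding is_H_presented_def H_rel_def by blast+
  have "carrier ?M \<subseteq> \<phi> ` carrier K"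
  proof
    fix p assume p: "p \<in> carrier ?M"
    obtain i j l where ijl: "p = (i, j, l)" by (metis surj_pair)
    let ?g = "a [^]\<^bsub>K\<^esub> nat i \<otimes>\<^bsub>K\<^esub> b [^]\<^bsub>K\<^esub> nat j \<otimes>\<^bsub>K\<^esub> c [^]\<^bsub>K\<^esub> nat l"
    have "\<phi> ?g = \<phi> a [^]\<^bsub>?M\<^esub> nat i \<otimes>\<^bsub>?M\<^esub> \<phi> b [^]\<^bsub>?M\<^esub> nat j \<otimes>\<^bsub>?M\<^esub> \<phi> c [^]\<^bsub>?M\<^esub> nat l"
      using abc by (simp add: \<phi>.hom_nat_pow)
    also have "\<dots> = p"
      unfolding \<phi>(2-4) H_model_pow using p by (simp add: H_model_def ijl)
    finally show "p \<in> \<phi> ` carrier K"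
      using abc by (metis K.m_closed K.nat_pow_closed image_eqI)
  qed
  then have "card (carrier ?M) \<le> card (carrier K)"
    using fin by (metis card_image_le card_mono finite_imageI order_trans)
  moreover have "card (carrier ?M) = 2 ^ n * 2 ^ m * 4"
    by (simp add: H_model_def card_cartesian_product nat_power_eq)
  ultimately show "2 ^ n * 2 ^ m * 4 \<le> card (carrier K)" by simp
qed

end

subsection \<open>Group algebras as rings of operators\<close>

text \<open>The group algebra of \<open>H\<close> depends on a term, so it is not a type. Additive
  endomorphisms of \<open>'h \<Rightarrow> 'k\<close> form a type of class \<open>ring_1\<close> in which it embeds by left multiplication.\<close>

typedef (overloaded) ('h, 'k::field) endo =
  "{F :: ('h \<Rightarrow> 'k) \<Rightarrow> 'h \<Rightarrow> 'k. \<forall>f g. F (\<lambda>h. f h + g h) = (\<lambda>h. F f h + F g h)}"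
  by (rule exI[of _ "\<lambda>f. f"]) simp

setup_lifting type_definition_endo

instantiation endo :: (type, field) ring_1
begin

lift_definition zero_endo :: "('a, 'b) endo" is "\<lambda>f h. 0" by simp
lift_definition one_endo :: "('a, 'b) endo" is "\<lambda>f. f" by simp
lift_definition plus_endo :: "('a, 'b) endo \<Rightarrow> ('a, 'b) endo \<Rightarrow> ('a, 'b) endo"
  is "\<lambda>F G f h. F f h + G f h" by (simp add: add_ac)
lift_definition minus_endo :: "('a, 'b) endo \<Rightarrow> ('a, 'b) endo \<Rightarrow> ('a, 'b) endo"
  is "\<lambda>F G f h. F f h - G f h" by (simp add: algebra_simps)
lift_definition uminus_endo :: "('a, 'b) endo \<Rightarrow> ('a, 'b) endo"
  is "\<lambda>F f h. - F f h" by simp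
lift_definition times_endo :: "('a, 'b) endo \<Rightarrow> ('a, 'b) endo \<Rightarrow> ('a, 'b) endo"
  is "\<lambda>F G f. F (G f)" by simp

instance
proof
  fix F G K :: "('a, 'b) endo"
  show "(0 :: ('a, 'b) endo) \<noteq> 1"
  proof (transfer, rule notI)
    assume "(\<lambda>(f :: 'a \<Rightarrow> 'b) (h :: 'a). 0 :: 'b) = (\<lambda>f. f)"
    from fun_cong[OF this, of "\<lambda>_. 1"] show False
      by (simp add: fun_eq_iff)
  qed
  show "F * (G + K) = F * G + F * K"
    by transfer (simp add: fun_eq_iff)
  show "F * G * K = F * (G * K)" "1 * F = F" "F * 1 = F" "(F + G) * K = F * K + G * K"
    "F + G + K = F + (G + K)" "F + G = G + F" "0 + F = F" "- F + F = 0" "F - G = F + - G"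
    by (transfer, simp (no_asm) add: add_ac)+
qed

end

section \<open>The group algebra of a finite group\<close>

locale finite_group = group G for G (structure) +
  assumes finite_carrier: "finite (carrier G)"
begin

lemma sum_reindex_left:
  assumes "u \<in> carrier G"
  shows "(\<Sum>v\<in>carrier G. F (u \<otimes> v)) = (\<Sum>w\<in>carrier G. F w)"
  by (rule sum.reindex_bij_witness[where i = "\<lambda>w. inv u \<otimes> w" and j = "\<lambda>v. u \<otimes> v"])
    (use assms in \<open>simp_all flip: m_assoc\<close>)

text \<open>A convolution paired with a test function \<open>F\<close>. The multiplicativity of left
  multiplication, of the augmentation and of linear extension all follow by choosing
  \<open>F\<close>.\<close>

lemma sum_galg_mult:
  "(\<Sum>w\<in>carrier G. galg_mult G f f' w * F w) =
   (\<Sum>u\<in>carrier G. \<Sum>v\<in>carrier G. f u * f' v * F (u \<otimes> v))" for F :: "'a \<Rightarrow> 'k::field"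
proof -
  have "(\<Sum>w\<in>carrier G. galg_mult G f f' w * F w) =
     (\<Sum>w\<in>carrier G. \<Sum>u\<in>carrier G. f u * f' (inv u \<otimes> w) * F w)"
    by (intro sum.cong) (simp_all add: galg_mult_def sum_distrib_right)
  also have "\<dots> = (\<Sum>u\<in>carrier G. \<Sum>w\<in>carrier G. f u * f' (inv u \<otimes> w) * F w)"
    by (rule sum.swap)
  also have "\<dots> = (\<Sum>u\<in>carrier G. \<Sum>v\<in>carrier G. f u * f' v * F (u \<otimes> v))"
  proof (rule sum.cong[OF refl])
    fix u assume "u \<in> carrier G"
    then show "(\<Sum>w\<in>carrier G. f u * f' (inv u \<otimes> w) * F w) = (\<Sum>v\<in>carrier G. f u * f' v * F (u \<otimes> v))"
      by (subst sum_reindex_left[symmetric, of u]) (auto intro!: sum.cong simp flip: m_assoc)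
  qed
  finally show ?thesis .
qed

text \<open>Left multiplication is extended to functions on the whole type by letting
  the group fix the points outside its carrier, so that \<open>delta \<one>\<close> acts as the identity.\<close>

definition act :: "'a \<Rightarrow> 'a \<Rightarrow> 'a" where
  "act u h = (if h \<in> carrier G then inv u \<otimes> h else h)"

lift_definition left_mult :: "('a \<Rightarrow> 'k::field) \<Rightarrow> ('a, 'k) endo"
  is "\<lambda>f g h. \<Sum>u\<in>carrier G. f u * g (act u h)"
  by (simp add: distrib_left sum.distrib)

lemma left_mult_mult:
  fixes f f' :: "'a \<Rightarrow> 'k::field"
  shows "left_mult (galg_mult G f f') = left_mult f * left_mult f'"
proof transfer
  fix f f' :: "'a \<Rightarrow> 'k::field"
  have "act (u \<otimes> v) h = act v (act u h)" if "u \<in> carrier G" "v \<in> carrier G" for u v h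
    using that by (simp add: act_def inv_mult_group m_assoc)
  then show "(\<lambda>g h. \<Sum>u\<in>carrier G. galg_mult G f f' u * g (act u h)) =
    (\<lambda>g h. \<Sum>u\<in>carrier G. f u * (\<Sum>v\<in>carrier G. f' v * g (act v (act u h))))"
    by (simp add: sum_galg_mult sum_distrib_left mult.assoc)
qed

lemma left_mult_add: "left_mult (galg_add f f') = left_mult f + left_mult f'"
  by transfer (simp add: galg_add_def distrib_right sum.distrib)

lemma left_mult_one: "left_mult (delta \<one> :: 'a \<Rightarrow> 'k::field) = 1"
proof transfer
  have "(\<Sum>u\<in>carrier G. delta \<one> u * g (act u h)) = g h" for g :: "'a \<Rightarrow> 'k::field" and h
  proof -
    have "(\<Sum>u\<in>carrier G. delta \<one> u * g (act u h)) = (\<Sum>u\<in>carrier G. if u = \<one> then g (act u h) else 0)"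
      by (intro sum.cong) (simp_all add: delta_def)
    then show ?thesis
      using finite_carrier by (simp add: act_def)
  qed
  then show "(\<lambda>(g :: 'a \<Rightarrow> 'k::field) h. \<Sum>u\<in>carrier G. delta \<one> u * g (act u h)) = (\<lambda>g. g)"
    by (simp add: fun_eq_iff)
qed

text \<open>The operator of \<open>f\<close> sends \<open>delta \<one>\<close> back to
  \<open>f\<close> on the carrier. Equations in the group algebra may thus be checked in the ring of
  operators.\<close>

lemma inj_on_left_mult: "inj_on left_mult (galg_carrier G :: ('a \<Rightarrow> 'k::field) set)"
proof (rule inj_onI)
  fix f f' :: "'a \<Rightarrow> 'k"
  assume f: "f \<in> galg_carrier G" "f' \<in> galg_carrier G" and eq: "left_mult f = left_mult f'"
  have eval: "(\<Sum>u\<in>carrier G. f u * delta \<one> (act u h)) = f h" if "h \<in> carrier G" for f :: "'a \<Rightarrow> 'k" and h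
  proof -
    have "(\<Sum>u\<in>carrier G. f u * delta \<one> (act u h)) = (\<Sum>u\<in>carrier G. if u = h then f u else 0)"
    proof (rule sum.cong[OF refl])
      fix u assume u: "u \<in> carrier G"
      have "inv u \<otimes> h = \<one> \<longleftrightarrow> u = h"
        using u that by (auto simp: inv_solve_left')
      then show "f u * delta \<one> (act u h) = (if u = h then f u else 0)"
        using that by (simp add: delta_def act_def)
    qed
    then show ?thesis using finite_carrier that by simp
  qed
  from eq have "\<forall>g h. (\<Sum>u\<in>carrier G. f u * g (act u h)) = (\<Sum>u\<in>carrier G. f' u * g (act u h))"
    by transfer meson
  then have sums: "(\<Sum>u\<in>carrier G. f u * delta \<one> (act u h)) = (\<Sum>u\<in>carrier G. f' u * delta \<one> (act u h))" for h
    by blast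
  show "f = f'"
  proof
    fix h
    show "f h = f' h"
    proof (cases "h \<in> carrier G")
      case True
      then show ?thesis
        using sums[of h] by (simp only: eval)
    qed (use f in \<open>simp add: galg_carrier_def\<close>)
  qed
qed

lemma galg_mult_closed: "galg_mult G f f' \<in> galg_carrier G"
  by (simp add: galg_carrier_def galg_mult_def)

lemma galg_add_closed: "f \<in> galg_carrier G \<Longrightarrow> f' \<in> galg_carrier G \<Longrightarrow> galg_add f f' \<in> galg_carrier G"
  by (simp add: galg_carrier_def galg_add_def)

lemma galg_smult_closed: "f \<in> galg_carrier G \<Longrightarrow> galg_smult r f \<in> galg_carrier G"
  by (simp add: galg_carrier_def galg_smult_def)

lemma delta_closed: "u \<in> carrier G \<Longrightarrow> delta u \<in> galg_carrier G"
  by (auto simp: galg_carrier_def delta_def)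

lemma galg_mult_smult_left: "galg_mult G (galg_smult r f) f' = galg_smult r (galg_mult G f f')"
  by (simp add: galg_mult_def galg_smult_def fun_eq_iff sum_distrib_left mult.assoc)

lemma galg_mult_smult_right: "galg_mult G f (galg_smult r f') = galg_smult r (galg_mult G f f')"
  by (simp add: galg_mult_def galg_smult_def fun_eq_iff sum_distrib_left mult_ac)

lemma galg_mult_delta_left:
  assumes "u \<in> carrier G"
  shows "galg_mult G (delta u) f = (\<lambda>h. if h \<in> carrier G then f (inv u \<otimes> h) else 0)"
proof -
  have "(\<Sum>v\<in>carrier G. delta u v * f (inv v \<otimes> h)) = f (inv u \<otimes> h)" for h
  proof -
    have "(\<Sum>v\<in>carrier G. delta u v * f (inv v \<otimes> h)) = (\<Sum>v\<in>carrier G. if v = u then f (inv v \<otimes> h) else 0)"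
      by (intro sum.cong) (simp_all add: delta_def)
    then show ?thesis using finite_carrier assms by simp
  qed
  then show ?thesis by (simp add: galg_mult_def fun_eq_iff)
qed

lemma galg_mult_delta:
  assumes "u \<in> carrier G" "v \<in> carrier G"
  shows "galg_mult G (delta u) (delta v) = delta (u \<otimes> v)"
proof -
  have "inv u \<otimes> h = v \<longleftrightarrow> h = u \<otimes> v" if "h \<in> carrier G" for h
    using that assms by (simp add: inv_solve_left')
  then show ?thesis
    unfolding galg_mult_delta_left[OF assms(1)] using assms by (auto simp: delta_def fun_eq_iff)
qed

lemma galg_mult_one: "f \<in> galg_carrier G \<Longrightarrow> galg_mult G (delta \<one>) f = f"
  by (auto simp: galg_mult_delta_left galg_carrier_def fun_eq_iff)

text \<open>A product vanishes outside the carrier whatever its factors are, so injectivity applies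
  and associativity is inherited from composition.\<close>

lemma galg_mult_assoc: "galg_mult G (galg_mult G f f') f'' = galg_mult G f (galg_mult G f' f'')"
  by (intro inj_onD[OF inj_on_left_mult] galg_mult_closed) (simp add: left_mult_mult mult.assoc)

lemma galg_monoid: "monoid (galg G)"
proof (rule monoidI)
  fix f assume f: "f \<in> carrier (galg G :: ('a \<Rightarrow> 'k::field) monoid)"
  have "galg_mult G f (delta \<one>) = f"
    by (intro inj_onD[OF inj_on_left_mult] galg_mult_closed)
      (use f in \<open>simp_all add: left_mult_mult left_mult_one galg_def\<close>)
  then show "f \<otimes>\<^bsub>galg G\<^esub> \<one>\<^bsub>galg G\<^esub> = f"
    by (simp add: galg_def)
qed (simp_all add: galg_def galg_mult_closed delta_closed galg_mult_one galg_mult_assoc)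

lemma left_mult_pow: "left_mult (f [^]\<^bsub>galg G\<^esub> (k::nat)) = left_mult f ^ k"
proof (induction k)
  case 0
  show ?case by (simp add: galg_def left_mult_one)
next
  case (Suc k)
  have "left_mult (f [^]\<^bsub>galg G\<^esub> Suc k) = left_mult (galg_mult G (f [^]\<^bsub>galg G\<^esub> k) f)"
    by (simp add: galg_def)
  then show ?case by (simp add: left_mult_mult Suc power_Suc2 del: power_Suc)
qed

lemma augmentation_mult: "augmentation G (galg_mult G f f') = augmentation G f * augmentation G f'"
  using sum_galg_mult[of f f' "\<lambda>_. 1"] by (simp add: augmentation_def sum_product)

lemma augmentation_add: "augmentation G (galg_add f f') = augmentation G f + augmentation G f'"
  by (simp add: augmentation_def galg_add_def sum.distrib)

lemma augmentation_delta: "u \<in> carrier G \<Longrightarrow> augmentation G (delta u) = 1"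
  using finite_carrier by (simp add: augmentation_def delta_def)

text \<open>Elements of \<open>endo\<close> are merely additive, so a scalar \<open>r\<close> is
  represented by the operator of \<open>r\<close> times the unit element. It commutes with all left
  multiplications.\<close>

lemma left_mult_scalar_commutes:
  fixes f :: "'a \<Rightarrow> 'k::field"
  shows "left_mult (galg_smult r (delta \<one>)) * left_mult f = left_mult f * left_mult (galg_smult r (delta \<one>))"
proof -
  have "galg_mult G (delta \<one>) f = galg_mult G f (delta \<one>)"
    by (intro inj_onD[OF inj_on_left_mult] galg_mult_closed) (simp add: left_mult_mult left_mult_one)
  then show ?thesis
    unfolding left_mult_mult[symmetric] galg_mult_smult_left galg_mult_smult_right by simp
qed

end

section \<open>Linear extension of a map from a group to a group algebra\<close>

definition linear_extension ::
  "('g, 'x) monoid_scheme \<Rightarrow> ('g \<Rightarrow> 'h \<Rightarrow> 'k) \<Rightarrow> ('g \<Rightarrow> 'k::field) \<Rightarrow> 'h \<Rightarrow> 'k" where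
  "linear_extension G \<phi> f = (\<lambda>h. \<Sum>g\<in>carrier G. f g * \<phi> g h)"

lemma linear_extension_add:
  "linear_extension G \<phi> (galg_add f f') = galg_add (linear_extension G \<phi> f) (linear_extension G \<phi> f')"
  by (simp add: linear_extension_def galg_add_def fun_eq_iff distrib_right sum.distrib)

lemma linear_extension_smult:
  "linear_extension G \<phi> (galg_smult r f) = galg_smult r (linear_extension G \<phi> f)"
  by (simp add: linear_extension_def galg_smult_def fun_eq_iff sum_distrib_left mult.assoc)

lemma linear_extension_delta:
  "finite (carrier G) \<Longrightarrow> g \<in> carrier G \<Longrightarrow> linear_extension G \<phi> (delta g) = \<phi> g"
  by (simp add: linear_extension_def delta_def fun_eq_iff if_distrib[of "\<lambda>x. x * _"] cong: if_cong)

lemma linear_extension_mult: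
  fixes G (structure) and H (structure)
  assumes "finite_group G"
    and hom: "\<And>g g'. g \<in> carrier G \<Longrightarrow> g' \<in> carrier G \<Longrightarrow> \<phi> (g \<otimes>\<^bsub>G\<^esub> g') = galg_mult H (\<phi> g) (\<phi> g')"
  shows "linear_extension G \<phi> (galg_mult G f f') =
    galg_mult H (linear_extension G \<phi> f) (linear_extension G \<phi> f')"
proof -
  interpret G: finite_group G by fact
  have "(\<Sum>w\<in>carrier G. galg_mult G f f' w * \<phi> w h) =
      galg_mult H (linear_extension G \<phi> f) (linear_extension G \<phi> f') h" for h
  proof (cases "h \<in> carrier H")
    case True
    have "(\<Sum>w\<in>carrier G. galg_mult G f f' w * \<phi> w h) =
      (\<Sum>g\<in>carrier G. \<Sum>g'\<in>carrier G. f g * f' g' * galg_mult H (\<phi> g) (\<phi> g') h)"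
      by (simp add: G.sum_galg_mult hom)
    also have "\<dots> = (\<Sum>g\<in>carrier G. \<Sum>g'\<in>carrier G. \<Sum>u\<in>carrier H.
        f g * \<phi> g u * (f' g' * \<phi> g' (inv\<^bsub>H\<^esub> u \<otimes>\<^bsub>H\<^esub> h)))"
      using True by (simp add: galg_mult_def sum_distrib_left mult_ac)
    also have "\<dots> = (\<Sum>g\<in>carrier G. \<Sum>u\<in>carrier H. \<Sum>g'\<in>carrier G.
        f g * \<phi> g u * (f' g' * \<phi> g' (inv\<^bsub>H\<^esub> u \<otimes>\<^bsub>H\<^esub> h)))"
      by (intro sum.cong[OF refl] sum.swap)
    also have "\<dots> = (\<Sum>u\<in>carrier H. \<Sum>g\<in>carrier G. \<Sum>g'\<in>carrier G.
        f g * \<phi> g u * (f' g' * \<phi> g' (inv\<^bsub>H\<^esub> u \<otimes>\<^bsub>H\<^esub> h)))"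
      by (rule sum.swap)
    also have "\<dots> = galg_mult H (linear_extension G \<phi> f) (linear_extension G \<phi> f') h"
      using True by (simp add: galg_mult_def linear_extension_def sum_product)
    finally show ?thesis .
  next
    case False
    then show ?thesis
      by (simp add: G.sum_galg_mult hom) (simp add: galg_mult_def)
  qed
  then show ?thesis
    by (simp add: linear_extension_def[of G \<phi> "galg_mult G f f'"])
qed

subsection \<open>The isomorphism\<close>

lemma sum_fun_apply: "(\<Sum>i\<in>I. F i) x = (\<Sum>i\<in>I. F i x :: 'k::comm_monoid_add)"
  by (induction I rule: infinite_finite_induct) simp_all

text \<open>A dimension count. Two elements with the same image give a linear relation in which some
  \<open>\<phi> g0\<close> has a nonzero coefficient. Then fewer than
  \<open>card (carrier G)\<close> vectors span the image, although it contains the independent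
  vectors \<open>delta h\<close> for \<open>h\<close> in \<open>H\<close>.\<close>

lemma linear_extension_injective:
  fixes G (structure) and H (structure) and \<phi> :: "'g \<Rightarrow> 'h \<Rightarrow> 'k::field"
  assumes fin: "finite (carrier G)" "finite (carrier H)"
    and card: "card (carrier G) \<le> card (carrier H)"
    and surj: "galg_carrier H \<subseteq> linear_extension G \<phi> ` galg_carrier G"
  shows "inj_on (linear_extension G \<phi>) (galg_carrier G)"
proof (rule ccontr)
  interpret V: vector_space "galg_smult :: 'k \<Rightarrow> ('h \<Rightarrow> 'k) \<Rightarrow> _"
    by unfold_locales (simp_all add: galg_smult_def fun_eq_iff algebra_simps)
  have ext: "linear_extension G \<phi> f = (\<Sum>g\<in>carrier G. galg_smult (f g) (\<phi> g))" for f
    by (simp add: linear_extension_def galg_smult_def fun_eq_iff sum_fun_apply)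
  have inj_delta: "inj (delta :: 'h \<Rightarrow> 'h \<Rightarrow> 'k)"
    by (rule injI) (metis delta_def zero_neq_one)
  have indep: "V.independent (delta ` carrier H)"
  proof (rule V.independent_if_scalars_zero)
    fix r :: "('h \<Rightarrow> 'k) \<Rightarrow> 'k" and d :: "'h \<Rightarrow> 'k"
    assume r: "(\<Sum>d\<in>delta ` carrier H. galg_smult (r d) d) = 0" and d: "d \<in> delta ` carrier H"
    then obtain h where h: "h \<in> carrier H" "d = delta h" by blast
    \<comment> \<open>Evaluating the vanishing combination at \<open>h\<close> isolates the
      coefficient of \<open>delta h\<close>.\<close>
    have "r d = (\<Sum>e\<in>delta ` carrier H. if e = d then r d else 0)"
      using fin d by simp
    also have "\<dots> = (\<Sum>e\<in>delta ` carrier H. galg_smult (r e) e h)"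
    proof (rule sum.cong[OF refl])
      fix e :: "'h \<Rightarrow> 'k" assume "e \<in> delta ` carrier H"
      then obtain h' where h': "e = delta h'" by blast
      show "(if e = d then r d else 0) = galg_smult (r e) e h"
      proof (cases "h' = h")
        case False
        then have "e \<noteq> d"
          unfolding h h' using inj_delta by (simp add: inj_eq)
        then show ?thesis
          using False by (simp add: h' galg_smult_def delta_def)
      qed (simp add: h h' galg_smult_def delta_def)
    qed
    also have "\<dots> = (\<Sum>e\<in>delta ` carrier H. galg_smult (r e) e) h"
      by (simp add: sum_fun_apply)
    finally show "r d = 0"
      using r by simp
  qed (use fin in simp)
  from inj_delta have card_delta: "card (delta ` carrier H :: ('h \<Rightarrow> 'k) set) = card (carrier H)"
    by (metis card_image inj_on_subset subset_UNIV)
  assume "\<not> inj_on (linear_extension G \<phi>) (galg_carrier G)"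
  then obtain f f' where ff: "f \<in> galg_carrier G" "f' \<in> galg_carrier G" "f \<noteq> f'"
    "linear_extension G \<phi> f = linear_extension G \<phi> f'"
    unfolding inj_on_def by blast
  then obtain g0 where g0: "f g0 \<noteq> f' g0" by blast
  then have g0_carrier: "g0 \<in> carrier G"
    using ff(1,2) by (cases "g0 \<in> carrier G") (simp_all add: galg_carrier_def)
  define r where "r g = f g - f' g" for g
  let ?T = "\<phi> ` (carrier G - {g0})"
  have "(\<Sum>g\<in>carrier G. galg_smult (r g) (\<phi> g)) = 0"
    using ff(4) by (simp add: r_def ext V.scale_left_diff_distrib sum_subtractf)
  then have "galg_smult (r g0) (\<phi> g0) = - (\<Sum>g\<in>carrier G - {g0}. galg_smult (r g) (\<phi> g))"
    using sum.remove[OF fin(1) g0_carrier, of "\<lambda>g. galg_smult (r g) (\<phi> g)"] by (simp add: eq_neg_iff_add_eq_0)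
  also have "\<dots> \<in> V.span ?T"
    by (intro V.span_neg V.span_sum V.span_scale V.span_base) auto
  finally have "galg_smult (r g0) (\<phi> g0) \<in> V.span ?T" .
  then have "galg_smult (inverse (r g0)) (galg_smult (r g0) (\<phi> g0)) \<in> V.span ?T"
    by (rule V.span_scale)
  then have "\<phi> g0 \<in> V.span ?T"
    using g0 by (simp add: r_def)
  then have "\<phi> g \<in> V.span ?T" if "g \<in> carrier G" for g
    using that by (cases "g = g0") (auto intro: V.span_base)
  then have "linear_extension G \<phi> f \<in> V.span ?T" for f
    unfolding ext by (intro V.span_sum V.span_scale)
  then have "linear_extension G \<phi> ` galg_carrier G \<subseteq> V.span ?T"
    by blast
  moreover have "delta ` carrier H \<subseteq> galg_carrier H"
    by (auto simp: galg_carrier_def delta_def)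
  ultimately have "delta ` carrier H \<subseteq> V.span ?T"
    using surj by (meson order_trans)
  then have "card (delta ` carrier H :: ('h \<Rightarrow> 'k) set) \<le> card ?T"
    using V.independent_span_bound[OF _ indep] fin by simp
  also have "\<dots> \<le> card (carrier G - {g0})"
    using fin by (intro card_image_le) simp
  also have "\<dots> < card (carrier G)"
    using card_Diff1_less[OF fin(1) g0_carrier] .
  finally show False
    using card card_delta by simp
qed

lemma char2_add_self:
  assumes "CHAR('k::field) = 2"
  shows "r + r = (0::'k)" "F + F = (0::('h, 'k) endo)"
proof -
  have "(2::'k) = 0"
    using of_nat_CHAR[where 'a = 'k] assms by simp
  then show 1: "r + r = 0" for r :: 'k
    by (simp flip: mult_2)
  show "F + F = 0"
    by transfer (simp (no_asm) add: 1)
qed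

text \<open>This supplies the hypothesis \<open>cover\<close> of
  \<open>subset_if_a_\<beta>_mem\<close>. In characteristic 2,
  \<open>(1 + u) v + (1 + v) = 1 + u v\<close> and \<open>(1 + u) u^(-1) = 1 + u^(-1)\<close>, so
  \<open>Q\<close> contains \<open>1 + u\<close> for every group element \<open>u\<close>. An
  element of the group algebra is then split term by term as
  \<open>r u = r + (1 + u) r\<close>.\<close>

lemma (in finite_group) left_mult_cover:
  fixes Q S :: "('a, 'k::field) endo set"
  defines "A \<equiv> left_mult ` galg_carrier G"
  assumes char2: "CHAR('k) = 2" and K: "K \<subseteq> carrier G" "generate G K = carrier G"
    and Q_add: "\<And>x y. x \<in> Q \<Longrightarrow> y \<in> Q \<Longrightarrow> x + y \<in> Q"
    and Q_mult: "\<And>x y. x \<in> Q \<Longrightarrow> y \<in> A \<Longrightarrow> x * y \<in> Q"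
    and Q_mem: "\<And>u. u \<in> K \<Longrightarrow> 1 + left_mult (delta u) \<in> Q" "Q \<noteq> {}"
    and S_add: "\<And>x y. x \<in> S \<Longrightarrow> y \<in> S \<Longrightarrow> x + y \<in> S"
    and S_mem: "\<And>r. left_mult (galg_smult r (delta \<one>)) \<in> S"
  shows "A \<subseteq> {s + x | s x. s \<in> S \<and> x \<in> Q}"
proof -
  note add_self = char2_add_self(2)[OF char2, where 'h = 'a]
  have add_self': "x + (x + y) = y" for x y :: "('a, 'k) endo"
    by (simp add: add_self flip: add.assoc)
  have mult_delta: "left_mult (delta u) * left_mult (delta v) = (left_mult (delta (u \<otimes> v)) :: ('a, 'k) endo)"
    if "u \<in> carrier G" "v \<in> carrier G" for u v
    using that by (simp add: galg_mult_delta flip: left_mult_mult)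
  have delta_A: "left_mult (delta u) \<in> A" if "u \<in> carrier G" for u
    using that by (simp add: A_def delta_closed)
  have smult_A: "left_mult (galg_smult r (delta \<one>)) \<in> A" for r
    by (simp add: A_def delta_closed galg_smult_closed)
  have Q_zero: "0 \<in> Q"
    using Q_mem(2) Q_add add_self by (metis all_not_in_conv)
  have Q_delta: "1 + left_mult (delta u) \<in> Q" if "u \<in> generate G K" for u
    using that
  proof induction
    case one
    show ?case by (simp add: left_mult_one add_self Q_zero)
  next
    case (incl u)
    then show ?case by (rule Q_mem)
  next
    case (inv u)
    then have u: "u \<in> carrier G" using K by blast
    have "(1 + left_mult (delta u)) * left_mult (delta (inv u)) \<in> Q"
      using inv u by (intro Q_mult Q_mem delta_A) auto
    then show ?case
      using u by (simp add: distrib_right mult_delta left_mult_one add.commute)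
  next
    case (eng u v)
    then have uv: "u \<in> carrier G" "v \<in> carrier G"
      using K by auto
    have "(1 + left_mult (delta u)) * left_mult (delta v) + (1 + left_mult (delta v)) \<in> Q"
      by (rule Q_add[OF Q_mult[OF eng.IH(1) delta_A[OF uv(2)]] eng.IH(2)])
    also have "(1 + left_mult (delta u)) * left_mult (delta v) + (1 + left_mult (delta v)) =
        (1 + left_mult (delta (u \<otimes> v)) :: ('a, 'k) endo)"
      using uv by (simp add: distrib_right mult_delta add_ac add_self')
    finally show ?case .
  qed
  have supported: "\<exists>s\<in>S. \<exists>x\<in>Q. left_mult f = s + x"
    if "finite D" "D \<subseteq> carrier G" "\<And>h. h \<notin> D \<Longrightarrow> f h = 0" for D and f :: "'a \<Rightarrow> 'k"
    using that
  proof (induction D arbitrary: f)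
    case empty
    then have "f = galg_smult 0 (delta \<one>)"
      by (auto simp: galg_smult_def)
    then show ?case
      using S_mem Q_zero by (metis add.right_neutral)
  next
    case (insert u D)
    have "\<exists>s\<in>S. \<exists>x\<in>Q. left_mult (f(u := 0)) = s + x"
      by (rule insert.IH) (use insert.prems in auto)
    then obtain s x where sx: "s \<in> S" "x \<in> Q" "left_mult (f(u := 0)) = s + x" by blast
    have "u \<in> carrier G" using insert.prems by simp
    define R :: "('a, 'k) endo" where "R = left_mult (galg_smult (f u) (delta \<one>))"
    have "f = galg_add (f(u := 0)) (galg_smult (f u) (galg_mult G (delta \<one>) (delta u)))"
      unfolding galg_mult_one[OF delta_closed[OF \<open>u \<in> carrier G\<close>]]
      by (auto simp: galg_add_def galg_smult_def delta_def)
    then have "left_mult f = s + x + R * left_mult (delta u)"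
      unfolding R_def sx(3)[symmetric]
      by (metis left_mult_add left_mult_mult galg_mult_smult_left)
    also have "\<dots> = (s + R) + (x + R * (1 + left_mult (delta u)))"
      by (simp add: distrib_left add_ac add_self')
    \<comment> \<open>\<open>Q\<close> is only closed under multiplication from the right, so the
      scalar has to be moved behind \<open>1 + u\<close>.\<close>
    also have "R * (1 + left_mult (delta u)) = (1 + left_mult (delta u)) * R"
      unfolding R_def by (simp add: distrib_left distrib_right left_mult_scalar_commutes)
    finally have eq: "left_mult f = (s + R) + (x + (1 + left_mult (delta u)) * R)" .
    have "s + R \<in> S"
      using sx S_add S_mem by (simp add: R_def)
    moreover have "x + (1 + left_mult (delta u)) * R \<in> Q"
      using \<open>u \<in> carrier G\<close> K
      by (intro Q_add[OF sx(2)] Q_mult Q_delta) (simp_all add: R_def smult_A)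
    ultimately show ?case
      using eq by blast
  qed
  show ?thesis
  proof
    fix F assume "F \<in> A"
    then obtain f where "f \<in> galg_carrier G" "F = left_mult f"
      by (auto simp: A_def)
    then show "F \<in> {s + x | s x. s \<in> S \<and> x \<in> Q}"
      using supported[OF finite_carrier order_refl, of f] unfolding galg_carrier_def by blast
  qed
qed

lemma (in finite_group) left_mult_H_relations:
  assumes rel: "H_rel G n m a b c" and "CHAR('k::field) = 2" "2 < m" "m < n"
  shows "H_relations (left_mult (delta a) :: ('a, 'k) endo) (left_mult (delta b)) (left_mult (delta c)) n m"
proof -
  have abc: "a \<in> carrier G" "b \<in> carrier G" "c \<in> carrier G"
    and pows: "a [^] ((2::nat) ^ n) = \<one>" "b [^] ((2::nat) ^ m) = \<one>" "c [^] (4::nat) = \<one>"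
    using rel unfolding H_rel_def by blast+
  note rels = H_rel_relations[OF rel]
  have mult: "left_mult (delta u) * left_mult (delta v) = (left_mult (delta (u \<otimes> v)) :: ('a, 'k) endo)"
    if "u \<in> carrier G" "v \<in> carrier G" for u v
    using that by (simp add: galg_mult_delta flip: left_mult_mult)
  have pow: "left_mult (delta u) ^ k = (left_mult (delta (u [^] k)) :: ('a, 'k) endo)"
    if "u \<in> carrier G" for u and k :: nat
    by (induction k) (use that in \<open>simp_all add: left_mult_one mult power_Suc2 del: power_Suc\<close>)
  show ?thesis
    by unfold_locales
      (use assms abc pows in \<open>simp_all add: mult pow rels left_mult_one char2_add_self\<close>)
qed

lemma (in monoid) Units_if_pow_eq_one:
  assumes "x \<in> carrier G" "x [^] (k::nat) = \<one>" "0 < k"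
  shows "x \<in> Units G"
proof -
  have "x [^] (k - 1) \<otimes> x = \<one>" "x \<otimes> x [^] (k - 1) = \<one>"
    using assms by (metis Suc_diff_1 nat_pow_Suc, metis Suc_diff_1 nat_pow_Suc2)
  then show ?thesis
    using assms(1) by (auto simp: Units_def)
qed

lemma (in group) G_rel_subgroup:
  assumes "G_rel G n m x y z" "subgroup K G" "x \<in> K" "y \<in> K" "z \<in> K"
  shows "G_rel (G\<lparr>carrier := K\<rparr>) n m x y z"
proof -
  interpret K: subgroup K G by fact
  have comm: "comm (G\<lparr>carrier := K\<rparr>) u v = comm G u v" "conj (G\<lparr>carrier := K\<rparr>) u v = conj G u v"
    if "u \<in> K" "v \<in> K" for u v
    using that assms(2) by (simp_all add: comm_def conj_def m_inv_consistent)
  show ?thesis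
    using assms(1) unfolding G_rel_def comm(1)[OF assms(4,3)] comm(2)[OF assms(5,3)] comm(2)[OF assms(5,4)]
      m_inv_consistent[OF assms(2,5)] nat_pow_consistent[symmetric]
    by (elim conjE, intro conjI) (use assms in simp_all)
qed

lemma (in group) generate_insert_comm:
  assumes "x \<in> carrier G" "y \<in> carrier G"
  shows "generate G {x, y, comm G y x} = generate G {x, y}"
proof
  have sub: "subgroup (generate G {x, y}) G"
    using assms by (intro generate_is_subgroup) auto
  interpret sub: subgroup "generate G {x, y}" G by fact
  have "x \<in> generate G {x, y}" "y \<in> generate G {x, y}"
    by (simp_all add: generate.incl)
  then have "comm G y x \<in> generate G {x, y}"
    by (simp add: comm_def)
  then show "generate G {x, y, comm G y x} \<subseteq> generate G {x, y}"
    by (intro generate_subgroup_incl sub) (auto intro: generate.incl)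
  show "generate G {x, y} \<subseteq> generate G {x, y, comm G y x}"
    by (intro mono_generate) auto
qed

theorem theorem7p4:
  fixes G :: "'g monoid" and x y z :: 'g
    and H :: "'h monoid" and a b c :: 'h
    and n m :: nat
  assumes "2 < m" and "m < n"
    and "is_G_presented G n m x y z"
    and "is_H_presented H n m a b c"
    and "CHAR('k::field) = 2"
  shows "let kH = (galg H :: ('h \<Rightarrow> 'k) monoid);
             \<alpha> = (delta a :: 'h \<Rightarrow> 'k);
             \<beta> = galg_mult H (galg_mult H (delta b)
                    (galg_add (galg_add (delta a) (delta b)) (delta (a \<otimes>\<^bsub>H\<^esub> b)))) (delta c);
             U = generate (units_of kH) {\<alpha>, \<beta>}
         in is_group_basis H U \<and> (units_of kH)\<lparr>carrier := U\<rparr> \<cong> G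
            \<and> galg_isomorphic G H TYPE('k)"
proof -
  have nm: "1 < n" "1 < m" using assms(1,2) by simp_all
  interpret H: group H using assms(4) by (simp add: is_H_presented_def)
  interpret H: finite_group H
    by unfold_locales (rule H_presented_card_ge(1)[OF nm assms(4)])
  interpret G: group G using assms(3) by (simp add: is_G_presented_def)
  have G_rel: "G_rel G n m x y z" "generate G {x, y, z} = carrier G"
    using assms(3) by (simp_all add: is_G_presented_def)
  interpret G: finite_group G
    using G.G_rel_generate(1)[OF G_rel(1)] G_rel(2) by unfold_locales simp
  have xyz: "x \<in> carrier G" "y \<in> carrier G" "z \<in> carrier G"
    using G_rel(1) unfolding G_rel_def by blast+
  have H_rel: "H_rel H n m a b c" "generate H {a, b, c} = carrier H"
    using assms(4) by (simp_all add: is_H_presented_def)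
  have abc: "a \<in> carrier H" "b \<in> carrier H" "c \<in> carrier H"
    using H_rel(1) unfolding H_rel_def by blast+
  have card: "card (carrier G) \<le> card (carrier H)"
    using G.G_rel_generate(2)[OF G_rel(1)] H_presented_card_ge(2)[OF nm assms(4)] G_rel(2) by simp

  \<comment> \<open>The elements \<open>\<alpha>\<close> and \<open>\<beta>\<close> and their
    operators\<close>
  define kH where "kH = (galg H :: ('h \<Rightarrow> 'k) monoid)"
  define \<alpha> where "\<alpha> = (delta a :: 'h \<Rightarrow> 'k)"
  define \<beta> :: "'h \<Rightarrow> 'k" where "\<beta> = galg_mult H (galg_mult H (delta b)
      (galg_add (galg_add (delta a) (delta b)) (delta (a \<otimes>\<^bsub>H\<^esub> b)))) (delta c)"
  define U where "U = generate (units_of kH) {\<alpha>, \<beta>}"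
  define L where "L = (H.left_mult :: ('h \<Rightarrow> 'k) \<Rightarrow> ('h, 'k) endo)"

  interpret R: H_relations "L (delta a)" "L (delta b)" "L (delta c)" n m
    unfolding L_def by (rule H.left_mult_H_relations[OF H_rel(1) assms(5,1,2)])
  have L_mult: "L (f \<otimes>\<^bsub>kH\<^esub> f') = L f * L f'" and L_pow: "L (f [^]\<^bsub>kH\<^esub> k) = L f ^ k"
    and L_one: "L \<one>\<^bsub>kH\<^esub> = 1" for f f' and k :: nat
    by (simp_all add: L_def kH_def H.left_mult_pow) (simp_all add: galg_def H.left_mult_mult H.left_mult_one)
  have carrier_kH: "carrier kH = galg_carrier H"
    by (simp add: kH_def galg_def)
  have L_inj: "f = f'" if "L f = L f'" "f \<in> carrier kH" "f' \<in> carrier kH" for f f'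
    using inj_onD[OF H.inj_on_left_mult, of f f'] that by (simp add: L_def carrier_kH)
  have L_\<beta>: "L \<beta> = R.\<beta>"
    unfolding R.\<beta>_def using abc by (simp add: \<beta>_def L_def H.left_mult_mult H.left_mult_add flip: H.galg_mult_delta)
  interpret kH: monoid kH
    unfolding kH_def by (rule H.galg_monoid)
  have closed: "\<alpha> \<in> carrier kH" "\<beta> \<in> carrier kH"
    unfolding carrier_kH \<alpha>_def \<beta>_def using abc by (simp_all add: H.delta_closed H.galg_mult_closed)
  have L_\<alpha>: "L \<alpha> = L (delta a)" by (simp add: \<alpha>_def)
  have pows: "\<alpha> [^]\<^bsub>kH\<^esub> ((2::nat) ^ n) = \<one>\<^bsub>kH\<^esub>" "\<beta> [^]\<^bsub>kH\<^esub> ((2::nat) ^ m) = \<one>\<^bsub>kH\<^esub>"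
    by (auto intro!: L_inj closed simp: L_pow L_one L_\<alpha> L_\<beta> R.a_power R.\<beta>_power)
  have units: "\<alpha> \<in> Units kH" "\<beta> \<in> Units kH"
    using kH.Units_if_pow_eq_one closed pows by (metis zero_less_numeral zero_less_power)+

  \<comment> \<open>The relations of \<open>G\<close> for \<open>\<alpha>\<close>,
    \<open>\<beta>\<close> and the map from \<open>G\<close> onto \<open>U\<close>\<close>
  interpret UG: group "units_of kH" by (rule kH.units_group)
  have UG_carrier: "carrier (units_of kH) = Units kH" by (simp add: units_of_def)
  define \<zeta> where "\<zeta> = comm (units_of kH) \<beta> \<alpha>"
  have UG_rel: "G_rel (units_of kH) n m \<alpha> \<beta> \<zeta>"
    unfolding \<zeta>_def
  proof (rule UG.G_rel_if_squares_central)
    show "\<alpha> \<in> carrier (units_of kH)" "\<beta> \<in> carrier (units_of kH)"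
      by (simp_all add: UG_carrier units)
    show "\<alpha> [^]\<^bsub>units_of kH\<^esub> ((2::nat) ^ n) = \<one>\<^bsub>units_of kH\<^esub>"
      "\<beta> [^]\<^bsub>units_of kH\<^esub> ((2::nat) ^ m) = \<one>\<^bsub>units_of kH\<^esub>"
      using pows by (simp_all add: kH.units_of_pow units units_of_one)
    show "\<beta> \<otimes>\<^bsub>units_of kH\<^esub> (\<alpha> \<otimes>\<^bsub>units_of kH\<^esub> \<alpha>) = \<alpha> \<otimes>\<^bsub>units_of kH\<^esub> \<alpha> \<otimes>\<^bsub>units_of kH\<^esub> \<beta>"
      unfolding units_of_mult
      by (rule L_inj) (use closed R.a_square_\<beta> in \<open>simp_all add: L_mult L_\<alpha> L_\<beta> power2_eq_square\<close>)
    show "\<alpha> \<otimes>\<^bsub>units_of kH\<^esub> (\<beta> \<otimes>\<^bsub>units_of kH\<^esub> \<beta>) = \<beta> \<otimes>\<^bsub>units_of kH\<^esub> \<beta> \<otimes>\<^bsub>units_of kH\<^esub> \<alpha>"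
      unfolding units_of_mult
      by (rule L_inj) (use closed R.a_\<beta>_square in \<open>simp_all add: L_mult L_\<alpha> L_\<beta> power2_eq_square\<close>)
    have "(\<alpha> \<otimes>\<^bsub>kH\<^esub> \<beta>) [^]\<^bsub>kH\<^esub> (4::nat) = (\<beta> \<otimes>\<^bsub>kH\<^esub> \<alpha>) [^]\<^bsub>kH\<^esub> (4::nat)"
      by (rule L_inj) (use closed R.a_\<beta>_fourth_power in \<open>simp_all add: L_mult L_pow L_\<alpha> L_\<beta>\<close>)
    then show "(\<alpha> \<otimes>\<^bsub>units_of kH\<^esub> \<beta>) [^]\<^bsub>units_of kH\<^esub> (4::nat) = (\<beta> \<otimes>\<^bsub>units_of kH\<^esub> \<alpha>) [^]\<^bsub>units_of kH\<^esub> (4::nat)"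
      by (simp add: units_of_mult kH.units_of_pow units)
  qed
  \<comment> \<open>The third generator of the presentation is a commutator of the other two, so
    adding it does not enlarge \<open>U\<close>.\<close>
  have U: "U = generate (units_of kH) {\<alpha>, \<beta>, \<zeta>}"
    unfolding U_def \<zeta>_def using units by (intro UG.generate_insert_comm[symmetric]) (simp_all add: UG_carrier)
  have U_gens: "{\<alpha>, \<beta>, \<zeta>} \<subseteq> U"
    unfolding U by (auto intro: generate.incl)
  have U_sub: "subgroup U (units_of kH)"
    unfolding U_def using units by (intro UG.generate_is_subgroup) (simp_all add: UG_carrier)
  define UU where "UU = (units_of kH)\<lparr>carrier := U\<rparr>"
  interpret UU: group UU
    unfolding UU_def by (rule UG.subgroup_imp_group[OF U_sub])
  have UU_rel: "G_rel UU n m \<alpha> \<beta> \<zeta>"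
    unfolding UU_def using U_gens by (intro UG.G_rel_subgroup[OF UG_rel U_sub]) auto
  \<comment> \<open>Finiteness follows from the relations of \<open>G\<close> and makes
    \<open>UU\<close> an admissible target for \<open>G_presented_hom\<close>.\<close>
  have "finite (carrier UU)"
    using UG.G_rel_generate(1)[OF UG_rel] by (simp add: UU_def U)
  then obtain \<phi> where \<phi>: "\<phi> \<in> hom G UU" "\<phi> x = \<alpha>" "\<phi> y = \<beta>" "\<phi> z = \<zeta>"
    using G_presented_hom[OF assms(3) UU.is_group _ UU_rel] by blast
  interpret \<phi>: group_hom G UU \<phi> by unfold_locales (rule \<phi>(1))
  have \<phi>_image: "\<phi> ` carrier G = U"
  proof -
    have "\<phi> ` generate G {x, y, z} = generate UU {\<alpha>, \<beta>, \<zeta>}"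
      using \<phi>.generate_img[of "{x, y, z}"] xyz \<phi> by simp
    also have "\<dots> = U"
      unfolding UU_def using UG.generate_consistent[OF U_gens U_sub] by (simp add: U)
    finally show ?thesis by (simp add: G_rel(2))
  qed
  have U_carrier: "U \<subseteq> galg_carrier H"
    using subgroup.subset[OF U_sub] by (auto simp: UG_carrier Units_def carrier_kH)
  have \<phi>_mult: "\<phi> (g \<otimes>\<^bsub>G\<^esub> g') = galg_mult H (\<phi> g) (\<phi> g')" if "g \<in> carrier G" "g' \<in> carrier G" for g g'
    using that \<phi>.hom_mult by (simp add: UU_def units_of_mult) (simp add: kH_def galg_def)
  have \<phi>_one: "\<phi> \<one>\<^bsub>G\<^esub> = delta \<one>\<^bsub>H\<^esub>"
    using \<phi>.hom_one by (simp add: UU_def units_of_one) (simp add: kH_def galg_def)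

  \<comment> \<open>The induced map of group algebras\<close>
  define E where "E = (linear_extension G \<phi> :: ('g \<Rightarrow> 'k) \<Rightarrow> ('h \<Rightarrow> 'k))"
  have E_mult: "E (galg_mult G f f') = galg_mult H (E f) (E f')" for f f'
    unfolding E_def by (rule linear_extension_mult[OF G.finite_group_axioms \<phi>_mult])
  have E_add: "E (galg_add f f') = galg_add (E f) (E f')" for f f'
    unfolding E_def by (rule linear_extension_add)
  have E_smult: "E (galg_smult r f) = galg_smult r (E f)" for r f
    unfolding E_def by (rule linear_extension_smult)
  have E_delta: "E (delta g) = \<phi> g" if "g \<in> carrier G" for g
    unfolding E_def by (rule linear_extension_delta[OF G.finite_carrier that])
  have E_closed: "E f \<in> galg_carrier H" for f
  proof -
    have "\<phi> g \<in> galg_carrier H" if "g \<in> carrier G" for g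
      using \<phi>_image U_carrier that by blast
    then show ?thesis
      by (simp add: E_def linear_extension_def galg_carrier_def)
  qed

  have E_onto: "galg_carrier H \<subseteq> E ` galg_carrier G"
  proof -
    \<comment> \<open>Both sides are compared as sets of operators, where the ring computation
      applies. Injectivity of \<open>L\<close> brings the inclusion back to the group
      algebra.\<close>
    let ?A = "L ` galg_carrier H" and ?S = "L ` E ` galg_carrier G"
    have "?A \<subseteq> ?S"
    proof (rule R.subset_if_a_\<beta>_mem)
      show "u + v \<in> ?A" if "u \<in> ?A" "v \<in> ?A" for u v
        using that by (auto simp: L_def H.galg_add_closed simp flip: H.left_mult_add)
      show "u * v \<in> ?A" if "u \<in> ?A" "v \<in> ?A" for u v
        using that by (auto simp: L_def H.galg_mult_closed simp flip: H.left_mult_mult)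
      show "u + v \<in> ?S" if "u \<in> ?S" "v \<in> ?S" for u v
        using that by (auto simp: L_def G.galg_add_closed simp flip: H.left_mult_add E_add)
      show "u * v \<in> ?S" if "u \<in> ?S" "v \<in> ?S" for u v
        using that by (auto simp: L_def G.galg_mult_closed simp flip: H.left_mult_mult E_mult)
      show "L (delta a) \<in> ?A" "L (delta b) \<in> ?A" "L (delta c) \<in> ?A"
        using abc by (simp_all add: H.delta_closed)
      show "1 \<in> ?A"
        using H.delta_closed[OF H.one_closed] by (force simp: L_def simp flip: H.left_mult_one)
      have mem: "L (\<phi> g) \<in> ?S" if "g \<in> carrier G" for g
        using G.delta_closed[OF that] E_delta[OF that] by force
      show "1 \<in> ?S"
        using mem[OF G.one_closed] unfolding \<phi>_one by (simp add: L_def H.left_mult_one)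
      show "L (delta a) \<in> ?S" "R.\<beta> \<in> ?S"
        using mem[OF xyz(1)] mem[OF xyz(2)] by (simp_all add: \<phi> L_\<alpha> L_\<beta>)
      fix Q
      assume Q: "\<And>u v. u \<in> Q \<Longrightarrow> v \<in> Q \<Longrightarrow> u + v \<in> Q" "\<And>u v. u \<in> Q \<Longrightarrow> v \<in> ?A \<Longrightarrow> u * v \<in> Q"
        "1 + L (delta a) \<in> Q" "1 + L (delta b) \<in> Q" "1 + L (delta c) \<in> Q"
      show "?A \<subseteq> {s + u | s u. s \<in> ?S \<and> u \<in> Q}"
        unfolding L_def
      proof (rule H.left_mult_cover[OF assms(5) _ H_rel(2)])
        show "H.left_mult (galg_smult r (delta \<one>\<^bsub>H\<^esub>)) \<in> H.left_mult ` E ` galg_carrier G" for r :: 'k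
          using E_smult[of r "delta \<one>\<^bsub>G\<^esub>"] E_delta[OF G.one_closed] \<phi>_one
            G.galg_smult_closed[OF G.delta_closed[OF G.one_closed], of r]
          by (metis image_eqI)
        show "u + v \<in> H.left_mult ` E ` galg_carrier G"
          if "u \<in> H.left_mult ` E ` galg_carrier G" "v \<in> H.left_mult ` E ` galg_carrier G" for u v
          using that by (auto simp: G.galg_add_closed simp flip: H.left_mult_add E_add)
      qed (use Q abc in \<open>auto simp: L_def\<close>)
    qed
    show ?thesis
    proof
      fix f :: "'h \<Rightarrow> 'k" assume f: "f \<in> galg_carrier H"
      then obtain f' where "f' \<in> galg_carrier G" "L f = L (E f')"
        using \<open>?A \<subseteq> ?S\<close> by blast
      then show "f \<in> E ` galg_carrier G"
        using L_inj[of f "E f'"] f E_closed by (simp add: carrier_kH)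
    qed
  qed
  \<comment> \<open>Surjectivity together with
    \<open>card (carrier G) \<le> card (carrier H)\<close> forces injectivity.\<close>
  have E_inj: "inj_on E (galg_carrier G)"
    using linear_extension_injective[OF G.finite_carrier H.finite_carrier card] E_onto
    unfolding E_def by blast
  have E_bij: "bij_betw E (galg_carrier G) (galg_carrier H)"
    unfolding bij_betw_def using E_inj E_onto E_closed by blast
  have \<phi>_inj: "inj_on \<phi> (carrier G)"
  proof (rule inj_onI)
    fix g g' assume g: "g \<in> carrier G" "g' \<in> carrier G" "\<phi> g = \<phi> g'"
    then have "(delta g :: 'g \<Rightarrow> 'k) = delta g'"
      by (intro inj_onD[OF E_inj]) (simp_all add: E_delta G.delta_closed)
    then show "g = g'"
      by (metis delta_def zero_neq_one)
  qed

  \<comment> \<open>The isomorphisms of groups and of group algebras\<close>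
  have iso: "UU \<cong> G"
  proof -
    have "\<phi> \<in> iso G UU"
      using \<phi>(1) \<phi>_inj \<phi>_image by (simp add: iso_def bij_betw_def UU_def)
    then show ?thesis
      using G.iso_sym is_isoI by blast
  qed
  have galg_iso: "galg_isomorphic G H TYPE('k)"
    unfolding galg_isomorphic_def
    using E_bij E_add E_mult E_smult E_delta[OF G.one_closed] \<phi>_one by (intro exI[of _ E]) simp

  \<comment> \<open>\<open>U\<close> is a basis\<close>
  have basis: "is_k_basis H U"
    unfolding is_k_basis_def
  proof (intro conjI ballI U_carrier)
    fix f :: "'h \<Rightarrow> 'k" assume "f \<in> galg_carrier H"
    have fin_U: "finite U"
      using \<phi>_image G.finite_carrier by blast
    \<comment> \<open>Coefficient families supported on \<open>U\<close> correspond under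
      \<open>\<phi>\<close> to elements of \<open>kG\<close>, and the linear combination is the
      value of \<open>E\<close>. Existence and uniqueness of coefficients thus become surjectivity
      and injectivity of \<open>E\<close>.\<close>
    have sum_U: "(\<lambda>h. \<Sum>u\<in>{u. r u \<noteq> 0}. r u * u h) = E (\<lambda>g. if g \<in> carrier G then r (\<phi> g) else 0)"
      if "{u. r u \<noteq> 0} \<subseteq> U" for r :: "('h \<Rightarrow> 'k) \<Rightarrow> 'k"
    proof
      fix h
      have "(\<Sum>u\<in>{u. r u \<noteq> 0}. r u * u h) = (\<Sum>u\<in>U. r u * u h)"
        using that fin_U by (intro sum.mono_neutral_left) auto
      also have "\<dots> = (\<Sum>g\<in>carrier G. r (\<phi> g) * \<phi> g h)"
        unfolding \<phi>_image[symmetric] using \<phi>_inj by (simp add: sum.reindex)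
      finally show "(\<Sum>u\<in>{u. r u \<noteq> 0}. r u * u h) = E (\<lambda>g. if g \<in> carrier G then r (\<phi> g) else 0) h"
        by (simp add: E_def linear_extension_def)
    qed
    obtain f0 where f0: "f0 \<in> galg_carrier G" "f = E f0"
      using E_onto \<open>f \<in> galg_carrier H\<close> by blast
    \<comment> \<open>The coordinates of \<open>f0\<close> are carried along \<open>\<phi>\<close>;
      the value 0 outside \<open>U\<close> keeps the support inside \<open>U\<close>.\<close>
    define r where "r u = (if u \<in> U then f0 (inv_into (carrier G) \<phi> u) else 0)" for u
    have r_sub: "{u. r u \<noteq> 0} \<subseteq> U" by (auto simp: r_def)
    have "(\<lambda>g. if g \<in> carrier G then r (\<phi> g) else 0) = f0"
      using f0(1) \<phi>_image \<phi>_inj by (auto simp: r_def galg_carrier_def fun_eq_iff)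
    then have r_f: "f = (\<lambda>h. \<Sum>u\<in>{u. r u \<noteq> 0}. r u * u h)"
      unfolding sum_U[OF r_sub] by (simp add: f0(2))
    show "\<exists>!r. finite {u. r u \<noteq> 0} \<and> {u. r u \<noteq> 0} \<subseteq> U \<and> f = (\<lambda>h. \<Sum>u\<in>{u. r u \<noteq> 0}. r u * u h)"
    proof (rule ex1I[of _ r])
      show "finite {u. r u \<noteq> 0} \<and> {u. r u \<noteq> 0} \<subseteq> U \<and> f = (\<lambda>h. \<Sum>u\<in>{u. r u \<noteq> 0}. r u * u h)"
        using r_sub r_f fin_U finite_subset by blast
      fix s :: "('h \<Rightarrow> 'k) \<Rightarrow> 'k"
      assume s: "finite {u. s u \<noteq> 0} \<and> {u. s u \<noteq> 0} \<subseteq> U \<and> f = (\<lambda>h. \<Sum>u\<in>{u. s u \<noteq> 0}. s u * u h)"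
      have "E (\<lambda>g. if g \<in> carrier G then s (\<phi> g) else 0) = E (\<lambda>g. if g \<in> carrier G then r (\<phi> g) else 0)"
        using s r_f sum_U[of s] sum_U[OF r_sub] by metis
      then have eq: "(\<lambda>g. if g \<in> carrier G then s (\<phi> g) else 0) = (\<lambda>g. if g \<in> carrier G then r (\<phi> g) else 0)"
        by (rule inj_onD[OF E_inj]) (simp_all add: galg_carrier_def)
      have "s u = r u" for u
      proof (cases "u \<in> U")
        case True
        then obtain g where "g \<in> carrier G" "u = \<phi> g" using \<phi>_image by blast
        then show ?thesis using fun_cong[OF eq, of g] by simp
      next
        case False
        then have "s u = 0" "r u = 0" using s r_sub by blast+
        then show ?thesis by simp
      qed
      then show "s = r" by blast
    qed
  qed

  \<comment> \<open>Elements of \<open>U\<close> have augmentation 1\<close>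
  have "augmentation H u = 1" if "u \<in> U" for u
  proof -
    have aug_mult: "augmentation H (v \<otimes>\<^bsub>units_of kH\<^esub> w) = augmentation H v * augmentation H w" for v w
      by (simp add: units_of_mult kH_def) (simp add: galg_def H.augmentation_mult)
    have aug_one: "augmentation H \<one>\<^bsub>units_of kH\<^esub> = (1::'k)"
      by (simp add: units_of_one kH_def) (simp add: galg_def H.augmentation_delta)
    \<comment> \<open>The factor \<open>a + b + a b\<close> of \<open>\<beta>\<close> has
      augmentation \<open>1 + 1 + 1\<close>, which is 1 in characteristic 2.\<close>
    have "(1::'k) + 1 = 0"
      by (rule char2_add_self(1)[OF assms(5)])
    then have aug_gens: "augmentation H \<alpha> = 1" "augmentation H \<beta> = 1"
      using abc by (simp_all add: \<alpha>_def \<beta>_def H.augmentation_mult H.augmentation_add H.augmentation_delta)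
    show ?thesis
      using that unfolding U_def
    proof induction
      case (inv v)
      have "v \<in> carrier (units_of kH)" using inv units by (auto simp: UG_carrier)
      then have "augmentation H v * augmentation H (inv\<^bsub>units_of kH\<^esub> v) = 1"
        by (simp add: aug_one flip: aug_mult)
      then show ?case using inv aug_gens by auto
    qed (use aug_one aug_gens aug_mult in auto)
  qed
  then have "U \<subseteq> normalized_units H"
    using subgroup.subset[OF U_sub] unfolding UG_carrier
    by (auto simp: normalized_units_def simp flip: kH_def)
  then have "is_group_basis H U"
    unfolding is_group_basis_def using U_sub basis by (simp add: kH_def)
  then show ?thesis
    unfolding Let_def using iso galg_iso
    unfolding UU_def U_def \<alpha>_def \<beta>_def kH_def by simp
qed

end
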